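(* Let $n\in\mathbb{N}$, let $K\subseteq\mathbb{R}^n$ be closed, and let $T=\sum_{\alpha\in\mathbb{N}_0^n} q_\alpha\,\partial^\alpha:\mathbb{R}[x_1,\dots,x_n]\to\mathbb{R}[x_1,\dots,x_n]$ be a linear operator with $q_\alpha\in\mathbb{R}[x_1,\dots,x_n]$. Let $S:\mathbb{R}^{\mathbb{N}_0^n}\to\mathbb{R}^{\mathbb{N}_0^n}$ be the dual operator of $T$, i.e. the linear map determined by $L_{Ss}(p)=L_s(Tp)$ for all $s\in\mathbb{R}^{\mathbb{N}_0^n}$ and $p\in\mathbb{R}[x_1,\dots,x_n]$. Then the following are equivalent: (i) $S$ maps $K$-moment sequences to $K$-moment sequences; (ii) for every $y\in K$, the sequence $(\alpha!\cdot q_\alpha(y))_{\alpha\in\mathbb{N}_0^n}$ is a $(K-y)$-moment sequence, where $K-y=\{k-y: k\in K\}$.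
   Context: Every linear map $T:\mathbb{R}[x_1,\dots,x_n]\to\mathbb{R}[x_1,\dots,x_n]$ can be written uniquely as $T=\sum_{\alpha}q_\alpha\partial^\alpha$ with polynomial coefficients $q_\alpha$. For a real sequence $s=(s_\alpha)_{\alpha\in\mathbb{N}_0^n}$, the Riesz functional $L_s:\mathbb{R}[x_1,\dots,x_n]\to\mathbb{R}$ is the linear map with $L_s(x^\alpha)=s_\alpha$. For a closed set $K\subseteq\mathbb{R}^n$, $s$ is a $K$-moment sequence if there is a (positive) Borel measure $\mu$ on $\mathbb{R}^n$ supported in $K$ with $\int|x^\alpha|\,d\mu<\infty$ and $s_\alpha=\int x^\alpha\,d\mu(x)$ for all $\alpha\in\mathbb{N}_0^n$. Multi-index notation: $\alpha!=\alpha_1!\cdots\alpha_n!$, $x^\alpha=x_1^{\alpha_1}\cdots x_n^{\alpha_n}$, $\partial^\alpha=\partial_1^{\alpha_1}\cdots\partial_n^{\alpha_n}$. *)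

theory Defs
  imports "HOL-Analysis.Analysis" "HOL-Library.Poly_Mapping" "HOL-Library.Function_Algebras"
begin

text \<open>Multi-indices alpha in N_0^n are functions 'n => nat for a finite index type 'n
  (so n = CARD('n)).  Real polynomials in n variables are finitely supported
  coefficient maps from multi-indices to reals.\<close>

type_synonym 'n mpoly = "('n \<Rightarrow> nat) \<Rightarrow>\<^sub>0 real"

definition mon_val :: "('n::finite \<Rightarrow> nat) \<Rightarrow> real^'n \<Rightarrow> real" where
  "mon_val \<alpha> x = (\<Prod>i\<in>UNIV. (x $ i) ^ (\<alpha> i))"

definition peval :: "'n::finite mpoly \<Rightarrow> real^'n \<Rightarrow> real" where
  "peval p x = (\<Sum>\<alpha>\<in>Poly_Mapping.keys p. Poly_Mapping.lookup p \<alpha> * mon_val \<alpha> x)"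

definition mfact :: "('n::finite \<Rightarrow> nat) \<Rightarrow> real" where
  "mfact \<alpha> = (\<Prod>i\<in>UNIV. fact (\<alpha> i))"

definition pderiv_multi :: "('n::finite \<Rightarrow> nat) \<Rightarrow> 'n mpoly \<Rightarrow> 'n mpoly" where
  "pderiv_multi \<alpha> p =
     (\<Sum>\<gamma>\<in>{\<gamma>\<in>Poly_Mapping.keys p. \<alpha> \<le> \<gamma>}.
        Poly_Mapping.single (\<gamma> - \<alpha>) (Poly_Mapping.lookup p \<gamma> * mfact \<gamma> / mfact (\<gamma> - \<alpha>)))"

text \<open>The operator T = sum_alpha q_alpha d^alpha.  For a given p only the (finitely many)
  alpha below some exponent of p contribute, all other terms vanish.\<close>
definition diff_op :: "(('n::finite \<Rightarrow> nat) \<Rightarrow> 'n mpoly) \<Rightarrow> 'n mpoly \<Rightarrow> 'n mpoly" where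
  "diff_op q p = (\<Sum>\<alpha>\<in>{\<alpha>. \<exists>\<gamma>\<in>Poly_Mapping.keys p. \<alpha> \<le> \<gamma>}. q \<alpha> * pderiv_multi \<alpha> p)"

definition riesz :: "(('n::finite \<Rightarrow> nat) \<Rightarrow> real) \<Rightarrow> 'n mpoly \<Rightarrow> real" where
  "riesz s p = (\<Sum>\<alpha>\<in>Poly_Mapping.keys p. Poly_Mapping.lookup p \<alpha> * s \<alpha>)"

text \<open>K-moment sequence: represented by a (positive) Borel measure on R^n supported in K
  (K closed, so support in K means the complement is null) with all moments absolutely
  integrable.\<close>
definition is_moment_seq :: "(real^'n::finite) set \<Rightarrow> (('n \<Rightarrow> nat) \<Rightarrow> real) \<Rightarrow> bool" where
  "is_moment_seq K s \<longleftrightarrow>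
     (\<exists>\<mu> :: (real^'n) measure. sets \<mu> = sets borel \<and> emeasure \<mu> (UNIV - K) = 0 \<and>
        (\<forall>\<alpha>. integrable \<mu> (mon_val \<alpha>) \<and> s \<alpha> = integral\<^sup>L \<mu> (mon_val \<alpha>)))"

end

theory Submission
  imports Defs "HOL-Probability.Probability"
begin

text \<open>By Leibniz' rule \<open>(T x^\<alpha>)(y)\<close> is obtained from \<open>(\<beta>! q\<^sub>\<beta>(y))\<^sub>\<beta>\<close> exactly as moments about the
  origin are obtained from moments about \<open>y\<close>, so (ii) says that \<open>((T x^\<alpha>)(y))\<^sub>\<alpha>\<close> is a \<open>K\<close>-moment
  sequence for all \<open>y \<in> K\<close>. Applying \<open>S\<close> to the moments of the Dirac measure at \<open>y\<close> shows that (i)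
  implies this.

  Conversely, let \<open>\<mu>\<^sub>y\<close> on \<open>K\<close> have moments \<open>(T x^\<alpha>)(y)\<close> and let \<open>\<nu>\<close> represent \<open>s\<close>. The mixture of
  the \<open>\<mu>\<^sub>y\<close> with respect to \<open>\<nu>\<close> would represent \<open>S s\<close>, but \<open>y \<mapsto> \<mu>\<^sub>y\<close> need not be measurable. Instead
  \<open>y\<close> is replaced by a representative of its cell in countable Borel partitions, chosen so fine that
  the moments of the resulting countable mixtures converge to \<open>S s\<close>. Bounded second moments give
  tightness, and any weak limit is supported in the closed set \<open>K\<close> and has the limit moments.
  Weak compactness in \<open>\<real>\<^sup>n\<close> is reduced to Helly's theorem on the line by a Borel coding
  \<open>\<real>\<^sup>n \<Rightarrow> \<real>\<close> with a continuous left inverse.\<close>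

section \<open>Weak compactness of tight sequences\<close>

text \<open>The digits after position \<open>m\<close> are at most \<open>D\<close>, so a geometric
  series dominates the tail; the choice \<open>B = 2 * D + 1\<close> makes its sum half a unit of
  the last place kept. The leading digit stays unbounded because it will carry integer
  parts.\<close>

lemma digit_expansion:
  fixes c :: "nat \<Rightarrow> nat" and D :: nat
  defines "B \<equiv> 2 * real D + 1"
  assumes D: "D \<ge> 1" and c: "\<And>l. c (Suc l) \<le> D"
  shows "summable (\<lambda>l. c l / B ^ l)"
    and "(\<Sum>l\<le>m. c l / B ^ l) \<le> (suminf (\<lambda>l. c l / B ^ l))"
    and "(suminf (\<lambda>l. c l / B ^ l)) \<le> (\<Sum>l\<le>m. c l / B ^ l) + 1 / (2 * B ^ m)"
proof -
  have B: "B > 1" using D by (simp add: B_def)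
  have g: "(\<lambda>l. (1 / B ^ m) * (D / B) * (1 / B) ^ l) sums (1 / (2 * B ^ m))" for m
  proof -
    have "(\<lambda>l. (1 / B ^ m) * (D / B) * (1 / B) ^ l) sums ((1 / B ^ m) * (D / B) * (1 / (1 - 1 / B)))"
      using B by (intro sums_mult geometric_sums) auto
    moreover have "(1 / B ^ m) * (D / B) * (1 / (1 - 1 / B)) = 1 / (2 * B ^ m)"
    proof -
      have "1 / (1 - 1 / B) = B / (2 * D)" using B D by (simp add: B_def field_simps)
      thus ?thesis using B D by simp
    qed
    ultimately show ?thesis by simp
  qed
  have le: "c (l + Suc m) / B ^ (l + Suc m) \<le> (1 / B ^ m) * (D / B) * (1 / B) ^ l" for l m
    using B c[of "l + m"] by (simp add: power_add power_one_over field_simps)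
  have s': "summable (\<lambda>l. c (l + Suc m) / B ^ (l + Suc m))" for m
    using B by (intro summable_comparison_test'[OF sums_summable[OF g[of m]], of 0])
      (use le[of _ m] in auto)
  show s: "summable (\<lambda>l. c l / B ^ l)"
    using s'[of 0] summable_iff_shift[of "\<lambda>l. c l / B ^ l" 1] by simp
  show "(\<Sum>l\<le>m. c l / B ^ l) \<le> (suminf (\<lambda>l. c l / B ^ l))"
    using B by (intro sum_le_suminf s) auto
  have "(suminf (\<lambda>l. c l / B ^ l)) = (suminf (\<lambda>l. c (l + Suc m) / B ^ (l + Suc m))) + (\<Sum>l\<le>m. c l / B ^ l)"
    using suminf_split_initial_segment[OF s, of "Suc m"] by (simp add: lessThan_Suc_atMost)
  moreover have "(suminf (\<lambda>l. c (l + Suc m) / B ^ (l + Suc m))) \<le> 1 / (2 * B ^ m)"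
    using suminf_le[OF le s' sums_summable[OF g]] sums_unique[OF g[of m]] by simp
  ultimately show "(suminf (\<lambda>l. c l / B ^ l)) \<le> (\<Sum>l\<le>m. c l / B ^ l) + 1 / (2 * B ^ m)" by simp
qed

text \<open>Each tail lies between 0 and half a unit of place \<open>k\<close>, so for
  \<open>k \<le> m\<close> the partial sums up to \<open>k\<close> differ by less than one unit.
  Scaled by \<open>B ^ k\<close> they are integers, hence equal, and digits are differences of
  consecutive partial sums.\<close>

lemma digit_expansion_close:
  fixes c c' :: "nat \<Rightarrow> nat" and D :: nat
  defines "B \<equiv> 2 * real D + 1"
  assumes D: "D \<ge> 1" and c: "\<And>l. c (Suc l) \<le> D" and c': "\<And>l. c' (Suc l) \<le> D"
    and close: "\<bar>(suminf (\<lambda>l. c l / B ^ l)) - (suminf (\<lambda>l. c' l / B ^ l))\<bar> < 1 / (2 * B ^ m)"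
    and "l \<le> m"
  shows "c l = c' l"
proof -
  have B: "B > 1" using D by (simp add: B_def)
  define P P' where "P = (\<lambda>m. \<Sum>l\<le>m. c l / B ^ l)" and "P' = (\<lambda>m. \<Sum>l\<le>m. c' l / B ^ l)"
  have scaled: "B ^ k * (\<Sum>l\<le>k. d l / B ^ l) \<in> \<int>" for k :: nat and d :: "nat \<Rightarrow> nat"
  proof -
    have "B ^ k * (\<Sum>l\<le>k. d l / B ^ l) = of_nat (\<Sum>l\<le>k. (2 * D + 1) ^ (k - l) * d l)"
      unfolding sum_distrib_left of_nat_sum
    proof (intro sum.cong refl)
      fix l assume "l \<in> {..k}"
      hence "B ^ k = B ^ (k - l) * B ^ l" by (simp flip: power_add)
      moreover have "real ((2 * D + 1) ^ (k - l)) = B ^ (k - l)" by (simp add: B_def add.commute)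
      ultimately show "B ^ k * (d l / B ^ l) = real ((2 * D + 1) ^ (k - l) * d l)"
        using B by simp
    qed
    thus ?thesis by (metis Ints_of_nat)
  qed
  have eqP: "P k = P' k" if "k \<le> m" for k
  proof -
    have "1 / (2 * B ^ m) \<le> 1 / (2 * B ^ k)"
      using B that by (simp add: frac_le power_increasing)
    hence "\<bar>P k - P' k\<bar> < 1 / B ^ k"
      using close digit_expansion(2,3)[where c = c and m = k, OF D c]
        digit_expansion(2,3)[where c = c' and m = k, OF D c']
      unfolding P_def P'_def B_def[symmetric] by (simp add: field_simps)
    hence "\<bar>P k - P' k\<bar> * B ^ k < 1"
      using B by (simp add: pos_less_divide_eq)
    also have "\<bar>P k - P' k\<bar> * B ^ k = \<bar>(P k - P' k) * B ^ k\<bar>"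
      using B by (simp add: abs_mult)
    also have "(P k - P' k) * B ^ k = B ^ k * P k - B ^ k * P' k"
      by (simp add: algebra_simps)
    finally have "\<bar>B ^ k * P k - B ^ k * P' k\<bar> < 1" .
    moreover have "B ^ k * P k - B ^ k * P' k \<in> \<int>"
      unfolding P_def P'_def by (intro Ints_diff scaled)
    ultimately have "B ^ k * P k - B ^ k * P' k = 0"
      by (metis Ints_nonzero_abs_less1)
    thus ?thesis using B by simp
  qed
  have "c l / B ^ l = c' l / B ^ l"
  proof (cases l)
    case 0
    thus ?thesis using eqP[of 0] by (simp add: P_def P'_def)
  next
    case (Suc k)
    thus ?thesis using eqP[of k] eqP[of "Suc k"] \<open>l \<le> m\<close> by (simp add: P_def P'_def)
  qed
  thus ?thesis using B by simp
qed

text \<open>The inverse of the coding is continuous although the coding itself is not: the digits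
  are spaced out in base \<open>2 * D + 1\<close>, as in a Cantor set, so that codes which are close agree
  in many leading digits.\<close>

lemma real_coding_exists:
  obtains h :: "real^'n::finite \<Rightarrow> real" and g :: "real \<Rightarrow> real^'n"
  where "h \<in> borel_measurable borel" and "continuous_on UNIV g" and "\<And>x. g (h x) = x"
    and "\<And>R. \<exists>A. \<forall>x. norm x \<le> R \<longrightarrow> \<bar>h x\<bar> \<le> A"
proof -
  \<comment> \<open>\<open>w l x\<close> names the dyadic cube of side 1 / 2 ^ l containing
    \<open>x\<close>. Level 0 of \<open>e\<close> stores the integer parts, each later level the
    next binary digit of every coordinate.\<close>
  define w :: "nat \<Rightarrow> real^'n \<Rightarrow> 'n \<Rightarrow> int" where "w l x = (\<lambda>j. \<lfloor>2 ^ l * x $ j\<rfloor>)" for l x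
  define e where "e l x = (case l of 0 \<Rightarrow> w 0 x | Suc k \<Rightarrow> (\<lambda>j. w (Suc k) x j - 2 * w k x j))"
    for l and x :: "real^'n"
  define E :: "('n \<Rightarrow> int) set" where "E = PiE UNIV (\<lambda>_. {0..1})"
  have finE: "finite E" by (auto simp: E_def intro: finite_PiE)
  \<comment> \<open>Codes of bit vectors lie below \<open>D\<close>; the \<open>Suc\<close>
    guarantees \<open>D \<ge> 1\<close>, so that the base exceeds 1.\<close>
  define D where "D = Suc (Max (to_nat ` E))"
  define c where "c x l = to_nat (e l x)" for x l
  have e_bit: "e (Suc l) x \<in> E" for l x
  proof -
    have "w (Suc l) x j - 2 * w l x j \<in> {0..1}" for j
      unfolding w_def power_Suc atLeastAtMost_iff by linarith
    thus ?thesis by (auto simp: e_def E_def)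
  qed
  have D: "D \<ge> 1" by (simp add: D_def)
  have c: "c x (Suc l) \<le> D" for x l
    using finE e_bit[of l x] by (simp add: D_def c_def le_SucI)
  define B where "B = 2 * real D + 1"
  have B: "B > 1" using D by (simp add: B_def)
  define h where "h x = (suminf (\<lambda>l. c x l / B ^ l))" for x
  have w_meas: "Measurable.pred borel (\<lambda>x. e l x = v)" for l v
  proof -
    have *: "Measurable.pred borel (\<lambda>x. e l x j = v j)" for j
      by (cases l) (simp_all add: e_def w_def)
    show ?thesis unfolding fun_eq_iff using * by (rule pred_intros_countable(1))
  qed
  have "(\<lambda>x. e l x) \<in> measurable borel (count_space UNIV)" for l
    by (subst measurable_count_space_eq_countable) (use w_meas in \<open>auto simp: pred_def vimage_def\<close>)
  hence [measurable]: "(\<lambda>x. real (c x l)) \<in> borel_measurable borel" for l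
    unfolding c_def by measurable
  have h_meas: "h \<in> borel_measurable borel"
    unfolding h_def by measurable
  have w_eq: "w m x = w m y" if "\<And>l. l \<le> m \<Longrightarrow> e l x = e l y" for m x y
    using that
  proof (induction m)
    case 0
    from this[of 0] show ?case by (simp add: e_def)
  next
    case (Suc m)
    hence "w m x = w m y" by simp
    moreover have "e (Suc m) x = e (Suc m) y" using Suc by simp
    ultimately show ?case by (auto simp: e_def fun_eq_iff)
  qed
  \<comment> \<open>Equal digits up to level \<open>m\<close> put both points in the same dyadic
    cube of side 1 / 2 ^ m.\<close>
  have close: "\<bar>x $ j - y $ j\<bar> \<le> 1 / 2 ^ m" if "\<bar>h x - h y\<bar> < 1 / (2 * B ^ m)" for x y m j
  proof -
    have "c x l = c y l" if "l \<le> m" for l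
      using digit_expansion_close[where c = "c x" and c' = "c y" and m = m and l = l, OF D c c] that \<open>\<bar>h x - h y\<bar> < _\<close>
      by (simp add: h_def B_def)
    hence "w m x = w m y" by (intro w_eq) (auto simp: c_def)
    hence "\<lfloor>2 ^ m * x $ j\<rfloor> = \<lfloor>2 ^ m * y $ j\<rfloor>" by (simp add: w_def fun_eq_iff)
    hence "\<bar>2 ^ m * (x $ j - y $ j)\<bar> \<le> 1" unfolding right_diff_distrib by linarith
    hence "\<bar>x $ j - y $ j\<bar> * 2 ^ m \<le> 1" by (simp add: abs_mult mult.commute)
    thus ?thesis by (simp add: pos_le_divide_eq)
  qed
  have uc: "\<exists>d>0. \<forall>x y. \<bar>h x - h y\<bar> < d \<longrightarrow> dist x y < \<epsilon>" if "\<epsilon> > 0" for \<epsilon>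
  proof -
    have "eventually (\<lambda>m. real CARD('n) * (1 / 2) ^ m < \<epsilon>) sequentially"
      by (rule order_tendstoD[OF _ that]) (intro tendsto_mult_right_zero LIMSEQ_realpow_zero; simp)
    then obtain m where m: "real CARD('n) * (1 / 2) ^ m < \<epsilon>"
      by (auto simp: eventually_sequentially)
    have "dist x y < \<epsilon>" if "\<bar>h x - h y\<bar> < 1 / (2 * B ^ m)" for x y
    proof -
      have "dist x y \<le> (\<Sum>j\<in>UNIV. \<bar>(x - y) $ j\<bar>)"
        unfolding dist_norm by (rule norm_le_l1_cart)
      also have "\<dots> \<le> (\<Sum>j\<in>(UNIV::'n set). 1 / 2 ^ m)"
        using close[OF that] by (intro sum_mono) simp
      also have "\<dots> < \<epsilon>" using m by (simp add: power_one_over)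
      finally show ?thesis .
    qed
    thus ?thesis using B by (intro exI[of _ "1 / (2 * B ^ m)"]) auto
  qed
  have inj: "inj h"
  proof (rule injI)
    fix x y assume "h x = h y"
    hence "dist x y < \<epsilon>" if "\<epsilon> > 0" for \<epsilon> using uc[OF that] by auto
    thus "x = y" by (metis dist_pos_lt less_irrefl)
  qed
  \<comment> \<open>By \<open>uc\<close> the inverse of the coding is uniformly continuous on the
    range, so it extends to the closure and from there, by Tietze, to the whole line.\<close>
  have "uniformly_continuous_on (range h) (inv h)"
    unfolding uniformly_continuous_on_def using uc inj
    by (auto simp: dist_real_def dist_commute abs_minus_commute)
  then obtain g0 where g0: "uniformly_continuous_on (closure (range h)) g0"
    "\<And>t. t \<in> range h \<Longrightarrow> inv h t = g0 t"
    using uniformly_continuous_on_extension_on_closure by metis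
  obtain g where g: "continuous_on UNIV g" "\<And>t. t \<in> closure (range h) \<Longrightarrow> g t = g0 t"
    by (rule Tietze_unbounded[of "closure (range h)" g0 UNIV])
       (use g0 in \<open>auto intro: uniformly_continuous_imp_continuous\<close>)
  have gh: "g (h x) = x" for x
    using g(2)[of "h x"] g0(2)[of "h x"] inj closure_subset[of "range h"] by auto
  have bdd: "\<exists>A. \<forall>x. norm x \<le> R \<longrightarrow> \<bar>h x\<bar> \<le> A" for R
  proof -
    \<comment> \<open>On a bounded set the integer parts take finitely many values, which bounds the
      leading digit; all further digits add at most 1/2.\<close>
    define W where "W = (PiE UNIV (\<lambda>_::'n. {\<lfloor>-R\<rfloor>..\<lfloor>R\<rfloor>}))"
    have finW: "finite W" by (auto simp: W_def intro: finite_PiE)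
    have "\<bar>h x\<bar> \<le> real (Max (to_nat ` W)) + 1 / 2" if "norm x \<le> R" for x
    proof -
      have "x $ j \<in> {-R..R}" for j
        using component_le_norm_cart[of x j] that by auto
      hence "e 0 x \<in> W" by (auto simp: W_def e_def w_def intro!: floor_mono)
      hence "c x 0 \<le> Max (to_nat ` W)" using finW by (simp add: c_def)
      moreover have "0 \<le> h x" "h x \<le> c x 0 + 1 / 2"
        using digit_expansion(2,3)[where c = "c x" and m = 0, OF D c] by (auto simp: h_def B_def)
      ultimately show ?thesis by linarith
    qed
    thus ?thesis by blast
  qed
  show thesis by (rule that[OF h_meas g(1) gh bdd])
qed

text \<open>The images under the coding are tight on the line because bounded sets have bounded
  codes, so Helly's theorem gives a weak limit along a subsequence. Its image under the left inverse
  \<open>g\<close> is the limit sought: \<open>f \<circ> g\<close> is bounded and continuous, and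
  \<open>g (h x) = x\<close> turns its integrals against the images into integrals of
  \<open>f\<close>.\<close>

lemma tight_weakly_convergent_subsequence:
  fixes \<mu> :: "nat \<Rightarrow> (real^'n::finite) measure"
  assumes prob: "\<And>k. prob_space (\<mu> k)" and sets_\<mu>[measurable_cong]: "\<And>k. sets (\<mu> k) = sets borel"
    and tight: "\<And>\<epsilon>. \<epsilon> > 0 \<Longrightarrow> \<exists>R. \<forall>k. measure (\<mu> k) {x. norm x \<le> R} > 1 - \<epsilon>"
  obtains r M where "strict_mono r" "prob_space M" "sets M = sets borel"
    "\<And>f::real^'n \<Rightarrow> real. continuous_on UNIV f \<Longrightarrow> bounded (range f) \<Longrightarrow>
      (\<lambda>k. integral\<^sup>L (\<mu> (r k)) f) \<longlonglongrightarrow> integral\<^sup>L M f"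
proof -
  obtain h :: "real^'n \<Rightarrow> real" and g where
    h[measurable]: "h \<in> borel_measurable borel" and g: "continuous_on UNIV g"
    and gh: "\<And>x. g (h x) = x" and bdd: "\<And>R. \<exists>A. \<forall>x. norm x \<le> R \<longrightarrow> \<bar>h x\<bar> \<le> A"
    by (rule real_coding_exists) blast
  have [measurable]: "g \<in> borel_measurable borel"
    by (rule borel_measurable_continuous_onI[OF g])
  define \<rho> where "\<rho> k = distr (\<mu> k) borel h" for k
  interpret \<mu>: prob_space "\<mu> k" for k by (rule prob)
  have dist: "real_distribution (\<rho> k)" for k
    unfolding \<rho>_def by (rule \<mu>.real_distribution_distr) measurable
  have sp: "space (\<mu> k) = UNIV" for k
    using sets_eq_imp_space_eq[OF sets_\<mu>] by simp
  have "tight \<rho>"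
    unfolding tight_def
  proof (intro conjI allI impI dist)
    fix \<epsilon> :: real assume "\<epsilon> > 0"
    then obtain R where R: "\<And>k. measure (\<mu> k) {x. norm x \<le> R} > 1 - \<epsilon>" using tight by blast
    obtain A where A: "\<And>x. norm x \<le> R \<Longrightarrow> \<bar>h x\<bar> \<le> A" using bdd[of R] by blast
    \<comment> \<open>The extra 1 keeps the point \<open>- \<bar>A\<bar>\<close> inside the
      half-open interval.\<close>
    have "measure (\<rho> k) {- \<bar>A\<bar> - 1<..\<bar>A\<bar>} > 1 - \<epsilon>" for k
    proof -
      have "1 - \<epsilon> < measure (\<mu> k) {x. norm x \<le> R}" by (rule R)
      also have "\<dots> \<le> measure (\<mu> k) (h -` {- \<bar>A\<bar> - 1<..\<bar>A\<bar>} \<inter> space (\<mu> k))"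
        by (rule \<mu>.finite_measure_mono) (use A in \<open>force simp: sp\<close>, measurable)
      also have "\<dots> = measure (\<rho> k) {- \<bar>A\<bar> - 1<..\<bar>A\<bar>}"
        unfolding \<rho>_def by (rule measure_distr[symmetric]) measurable
      finally show ?thesis .
    qed
    thus "\<exists>a b. a < b \<and> (\<forall>k. 1 - \<epsilon> < measure (\<rho> k) {a<..b})"
      by (intro exI[of _ "- \<bar>A\<bar> - 1"] exI[of _ "\<bar>A\<bar>"]) auto
  qed
  from tight_imp_convergent_subsubsequence[OF this strict_mono_id] obtain r N where
    r: "strict_mono r" and N: "real_distribution N" and conv: "weak_conv_m (\<rho> \<circ> r) N"
    by (auto simp: comp_def)
  interpret N: real_distribution N by (rule N)
  define M where "M = distr N borel g"
  show thesis
  proof (rule that[OF r])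
    show "prob_space M" unfolding M_def by (rule N.prob_space_distr) measurable
    show "sets M = sets borel" by (simp add: M_def)
    fix f :: "real^'n \<Rightarrow> real" assume f: "continuous_on UNIV f" "bounded (range f)"
    have [measurable]: "f \<in> borel_measurable borel"
      by (rule borel_measurable_continuous_onI[OF f(1)])
    obtain C where C: "\<And>x. norm (f x) \<le> C" using f(2) by (auto simp: bounded_iff)
    have "continuous_on UNIV (\<lambda>t. f (g t))"
      by (rule continuous_on_compose2[OF f(1) g]) auto
    hence "isCont (\<lambda>t. f (g t)) t" for t
      by (simp add: continuous_on_eq_continuous_at)
    from weak_conv_imp_integral_bdd_continuous_conv[OF _ N conv this C]
    have "(\<lambda>k. integral\<^sup>L (\<rho> (r k)) (\<lambda>t. f (g t))) \<longlonglongrightarrow> integral\<^sup>L N (\<lambda>t. f (g t))"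
      using dist by (simp add: comp_def)
    moreover have "integral\<^sup>L (\<rho> k) (\<lambda>t. f (g t)) = integral\<^sup>L (\<mu> k) f" for k
      unfolding \<rho>_def by (subst integral_distr) (auto simp: gh)
    moreover have "integral\<^sup>L N (\<lambda>t. f (g t)) = integral\<^sup>L M f"
      unfolding M_def by (subst integral_distr) auto
    ultimately show "(\<lambda>k. integral\<^sup>L (\<mu> (r k)) f) \<longlonglongrightarrow> integral\<^sup>L M f" by simp
  qed
qed

section \<open>Limits of moment sequences\<close>

lemma mon_val_0: "mon_val (\<lambda>_. 0) x = 1"
  by (simp add: mon_val_def)

lemma mon_val_add: "mon_val (\<alpha> + \<beta>) x = mon_val \<alpha> x * mon_val \<beta> x"
  by (simp add: mon_val_def power_add prod.distrib)

lemma continuous_on_mon_val: "continuous_on S (mon_val \<alpha>)"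
  unfolding mon_val_def by (intro continuous_intros)

lemma measurable_mon_val[measurable]: "mon_val \<alpha> \<in> borel_measurable borel"
  by (rule borel_measurable_continuous_onI[OF continuous_on_mon_val])

section \<open>Truncation and tightness from second moments\<close>

text \<open>Completing the square. It serves to bound a monomial by its square, the monomial of
  index \<open>\<alpha> + \<alpha>\<close>, with a weight of free choice, plus a constant.\<close>

lemma abs_le_eps_square:
  fixes \<epsilon> t :: real
  assumes "\<epsilon> > 0"
  shows "\<bar>t\<bar> \<le> \<epsilon> * (t * t) + inverse \<epsilon>"
proof -
  have "0 \<le> (\<epsilon> * \<bar>t\<bar> - 1)\<^sup>2" by simp
  hence "2 * \<epsilon> * \<bar>t\<bar> \<le> \<epsilon> * \<epsilon> * (t * t) + 1"
    by (simp add: power2_eq_square algebra_simps)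
  also have "\<dots> = \<epsilon> * (\<epsilon> * (t * t) + inverse \<epsilon>)"
    using \<open>\<epsilon> > 0\<close> by (simp add: algebra_simps)
  finally have "\<epsilon> * (2 * \<bar>t\<bar>) \<le> \<epsilon> * (\<epsilon> * (t * t) + inverse \<epsilon>)"
    by (simp add: mult_ac)
  hence "2 * \<bar>t\<bar> \<le> \<epsilon> * (t * t) + inverse \<epsilon>" using \<open>\<epsilon> > 0\<close> by simp
  thus ?thesis by linarith
qed

text \<open>Truncation changes a value t only where |t| > R, and there |t| \<le> t * t / R. A bound
  on second moments thus controls the error uniformly over a family of measures, which lets
  unbounded functions pass through weak limits.\<close>

lemma truncation_error:
  fixes u :: "'a \<Rightarrow> real"
  assumes M: "finite_measure M" and u[measurable]: "u \<in> borel_measurable M"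
    and sq: "integrable M (\<lambda>x. u x * u x)" and R: "R > 0"
  shows "integrable M u"
    and "\<bar>integral\<^sup>L M u - integral\<^sup>L M (\<lambda>x. max (-R) (min R (u x)))\<bar>
           \<le> integral\<^sup>L M (\<lambda>x. u x * u x) / R"
proof -
  interpret finite_measure M by (rule M)
  have "\<bar>t\<bar> \<le> 1 + t * t" for t :: real
    using abs_le_eps_square[of 1 t] by simp
  thus u_int: "integrable M u"
    by (intro Bochner_Integration.integrable_bound[OF _ u, of "\<lambda>x. 1 + u x * u x"]) (use sq in auto)
  have t_int: "integrable M (\<lambda>x. max (-R) (min R (u x)))"
    by (rule integrable_const_bound[of _ R]) (use R in auto)
  have err: "\<bar>t - max (-R) (min R t)\<bar> \<le> t * t / R" for t
  proof (cases "\<bar>t\<bar> \<le> R")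
    case True
    thus ?thesis using R by (auto simp: max_def min_def)
  next
    case False
    have "\<bar>t - max (-R) (min R t)\<bar> * R \<le> \<bar>t\<bar> * \<bar>t\<bar>"
      by (intro mult_mono) (use False R in \<open>auto simp: max_def min_def\<close>)
    thus ?thesis using R by (simp add: pos_le_divide_eq)
  qed
  have "\<bar>integral\<^sup>L M u - integral\<^sup>L M (\<lambda>x. max (-R) (min R (u x)))\<bar>
      = \<bar>integral\<^sup>L M (\<lambda>x. u x - max (-R) (min R (u x)))\<bar>"
    using u_int t_int by simp
  also have "\<dots> \<le> integral\<^sup>L M (\<lambda>x. \<bar>u x - max (-R) (min R (u x))\<bar>)"
    by (rule integral_abs_bound)
  also have "\<dots> \<le> integral\<^sup>L M (\<lambda>x. u x * u x / R)"
    using u_int t_int sq err by (intro integral_mono) auto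
  finally show "\<bar>integral\<^sup>L M u - integral\<^sup>L M (\<lambda>x. max (-R) (min R (u x)))\<bar>
      \<le> integral\<^sup>L M (\<lambda>x. u x * u x) / R" by simp
qed

text \<open>Monotone convergence along integer truncation levels; the bound \<open>C\<close> makes
  the increasing integrals converge.\<close>

lemma integrable_of_bounded_truncations:
  fixes v :: "'a \<Rightarrow> real"
  assumes M: "finite_measure M" and v[measurable]: "v \<in> borel_measurable M"
    and nonneg: "\<And>x. v x \<ge> 0"
    and bound: "\<And>R. R > 0 \<Longrightarrow> integral\<^sup>L M (\<lambda>x. min R (v x)) \<le> C"
  shows "integrable M v" and "integral\<^sup>L M v \<le> C"
proof -
  interpret finite_measure M by (rule M)
  define f where "f n x = min (real (Suc n)) (v x)" for n x
  have f_int: "integrable M (f n)" for n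
    unfolding f_def by (rule integrable_const_bound[of _ "real (Suc n)"]) (use nonneg in auto)
  have f_mono: "mono (\<lambda>n. f n x)" for x
    by (auto simp: mono_def f_def)
  have f_lim: "(\<lambda>n. f n x) \<longlonglongrightarrow> v x" for x
  proof (rule tendsto_eventually)
    obtain N where "v x \<le> real N" using real_arch_simple by blast
    thus "eventually (\<lambda>n. f n x = v x) sequentially"
      by (auto simp: f_def eventually_sequentially min_def intro!: exI[of _ N])
  qed
  have "incseq (\<lambda>n. integral\<^sup>L M (f n))"
    by (intro incseq_SucI integral_mono f_int) (auto simp: f_def)
  moreover have fC: "integral\<^sup>L M (f n) \<le> C" for n
    unfolding f_def by (rule bound) simp
  ultimately obtain L where L: "(\<lambda>n. integral\<^sup>L M (f n)) \<longlonglongrightarrow> L"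
    using incseq_convergent[of _ C] by metis
  show "integrable M v"
    by (rule integrable_monotone_convergence[OF f_int _ _ L v]) (use f_mono f_lim in auto)
  have "integral\<^sup>L M v = L"
    by (rule integral_monotone_convergence[OF f_int _ _ L v]) (use f_mono f_lim in auto)
  thus "integral\<^sup>L M v \<le> C" using L fC by (auto intro: LIMSEQ_le_const2)
qed

text \<open>Markov's inequality for the squared Euclidean norm, whose expectation is the sum of the
  coordinate second moments.\<close>

lemma tight_of_second_moments:
  fixes \<mu> :: "nat \<Rightarrow> (real^'n::finite) measure"
  assumes prob: "\<And>k. prob_space (\<mu> k)" and sets_\<mu>[measurable_cong]: "\<And>k. sets (\<mu> k) = sets borel"
    and int: "\<And>k i. integrable (\<mu> k) (\<lambda>x. (x $ i)\<^sup>2)"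
    and bdd: "\<And>i. Bseq (\<lambda>k. integral\<^sup>L (\<mu> k) (\<lambda>x. (x $ i)\<^sup>2))"
    and "\<epsilon> > 0"
  shows "\<exists>R. \<forall>k. measure (\<mu> k) {x. norm x \<le> R} > 1 - \<epsilon>"
proof -
  interpret \<mu>: prob_space "\<mu> k" for k by (rule prob)
  have sp: "space (\<mu> k) = UNIV" for k
    using sets_eq_imp_space_eq[OF sets_\<mu>] by simp
  have "\<exists>C. \<forall>k. \<bar>integral\<^sup>L (\<mu> k) (\<lambda>x. (x $ i)\<^sup>2)\<bar> \<le> C" for i
    using bdd[of i] by (auto simp: Bseq_def)
  then obtain C where C: "\<And>i k. \<bar>integral\<^sup>L (\<mu> k) (\<lambda>x. (x $ i)\<^sup>2)\<bar> \<le> C i" by metis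
  define D where "D = 1 + (\<Sum>i\<in>UNIV. C i)"
  have "C i \<ge> 0" for i using C[of 0 i] by linarith
  hence D: "D > 0" by (simp add: D_def sum_nonneg add_pos_nonneg)
  have norm_sq: "(norm x)\<^sup>2 = (\<Sum>i\<in>UNIV. (x $ i)\<^sup>2)" for x :: "real^'n"
    by (simp add: norm_vec_def L2_set_def sum_nonneg)
  have n_int: "integrable (\<mu> k) (\<lambda>x. (norm x)\<^sup>2)" for k
    unfolding norm_sq using int by auto
  have n_le: "integral\<^sup>L (\<mu> k) (\<lambda>x. (norm x)\<^sup>2) \<le> D" for k
  proof -
    have "integral\<^sup>L (\<mu> k) (\<lambda>x. (norm x)\<^sup>2) = (\<Sum>i\<in>UNIV. integral\<^sup>L (\<mu> k) (\<lambda>x. (x $ i)\<^sup>2))"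
      unfolding norm_sq using int by (intro Bochner_Integration.integral_sum) auto
    also have "\<dots> \<le> (\<Sum>i\<in>UNIV. C i)" by (intro sum_mono) (use C in \<open>auto intro: order_trans[OF abs_ge_self]\<close>)
    finally show ?thesis by (simp add: D_def)
  qed
  \<comment> \<open>With this threshold the Markov bound \<open>D / c\<close> equals
    \<open>\<epsilon> / 2\<close>.\<close>
  define c where "c = 2 * D / \<epsilon>"
  have c: "c > 0" using D \<open>\<epsilon> > 0\<close> by (simp add: c_def)
  have "measure (\<mu> k) {x. norm x \<le> sqrt c} > 1 - \<epsilon>" for k
  proof -
    have "measure (\<mu> k) {x \<in> space (\<mu> k). (norm x)\<^sup>2 \<ge> c} \<le> integral\<^sup>L (\<mu> k) (\<lambda>x. (norm x)\<^sup>2) / c"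
      by (rule integral_Markov_inequality_measure[OF n_int, of "{}"]) (use c in auto)
    also have "\<dots> \<le> D / c" using n_le c by (intro divide_right_mono) auto
    also have "\<dots> < \<epsilon>" using D \<open>\<epsilon> > 0\<close> by (simp add: c_def)
    finally have "1 - \<epsilon> < 1 - measure (\<mu> k) {x \<in> space (\<mu> k). (norm x)\<^sup>2 \<ge> c}" by simp
    also have "\<dots> = measure (\<mu> k) (space (\<mu> k) - {x \<in> space (\<mu> k). (norm x)\<^sup>2 \<ge> c})"
      by (rule \<mu>.prob_compl[symmetric]) measurable
    also have "\<dots> \<le> measure (\<mu> k) {x. norm x \<le> sqrt c}"
      by (rule \<mu>.finite_measure_mono) (auto simp: sp not_le intro!: real_le_rsqrt)
    finally show ?thesis .
  qed
  thus ?thesis by blast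
qed

lemma mon_val_square: "mon_val (\<lambda>j. if j = i then 2 else 0) x = (x $ i)\<^sup>2"
proof -
  have "(x $ j) ^ (if j = i then 2 else 0) = (if j = i then (x $ j)\<^sup>2 else 1)" for j
    by simp
  thus ?thesis unfolding mon_val_def by (simp only: prod.delta finite UNIV_I if_True)
qed

lemma abs_le_by_eps:
  fixes a C :: real
  assumes "\<And>\<epsilon>. \<epsilon> > 0 \<Longrightarrow> \<bar>a\<bar> \<le> \<epsilon> * C"
  shows "a = 0"
proof (rule ccontr)
  assume "a \<noteq> 0"
  hence C: "C > 0" using assms[of 1] by simp
  have "\<bar>a\<bar> \<le> \<bar>a\<bar> / (2 * C) * C" using \<open>a \<noteq> 0\<close> C by (intro assms) auto
  thus False using C \<open>a \<noteq> 0\<close> by simp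
qed

text \<open>Convergent second moments are bounded, so the sequence is tight and has a weak limit
  along a subsequence. Weak convergence sees only bounded functions; the moments of index
  \<open>\<alpha> + \<alpha>\<close> bound the truncation errors and so carry the moments of index
  \<open>\<alpha>\<close> to the limit. Integrability is asked for only eventually because the
  mixtures used later control finitely many moments at each stage.\<close>

lemma prob_limit_of_moments:
  fixes \<mu> :: "nat \<Rightarrow> (real^'n::finite) measure" and K :: "(real^'n) set"
  assumes prob: "\<And>k. prob_space (\<mu> k)" and sets_\<mu>[measurable_cong]: "\<And>k. sets (\<mu> k) = sets borel"
    and K: "closed K" and supp: "\<And>k. emeasure (\<mu> k) (UNIV - K) = 0"
    and int: "\<And>\<alpha>. eventually (\<lambda>k. integrable (\<mu> k) (mon_val \<alpha>)) sequentially"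
    and int2: "\<And>k i. integrable (\<mu> k) (\<lambda>x. (x $ i)\<^sup>2)"
    and lim: "\<And>\<alpha>. (\<lambda>k. integral\<^sup>L (\<mu> k) (mon_val \<alpha>)) \<longlonglongrightarrow> s \<alpha>"
  obtains M where "prob_space M" "sets M = sets borel" "emeasure M (UNIV - K) = 0"
    "\<And>\<alpha>. integrable M (mon_val \<alpha>)" "\<And>\<alpha>. integral\<^sup>L M (mon_val \<alpha>) = s \<alpha>"
proof -
  interpret \<mu>: prob_space "\<mu> k" for k by (rule prob)
  have sp: "space (\<mu> k) = UNIV" for k
    using sets_eq_imp_space_eq[OF sets_\<mu>] by simp
  have "Bseq (\<lambda>k. integral\<^sup>L (\<mu> k) (\<lambda>x. (x $ i)\<^sup>2))" for i
    using lim[of "\<lambda>j. if j = i then 2 else 0"] unfolding mon_val_square[abs_def]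
    by (rule convergent_imp_Bseq[OF convergentI])
  note tight = tight_of_second_moments[OF prob sets_\<mu> int2 this]
  obtain r M where
    r: "strict_mono r" and M: "prob_space M" and sets_M[measurable_cong]: "sets M = sets borel"
    and conv: "\<And>f::real^'n \<Rightarrow> real. continuous_on UNIV f \<Longrightarrow> bounded (range f) \<Longrightarrow>
      (\<lambda>k. integral\<^sup>L (\<mu> (r k)) f) \<longlonglongrightarrow> integral\<^sup>L M f"
    by (rule tight_weakly_convergent_subsequence[OF prob sets_\<mu> tight]) blast+
  interpret M: prob_space M by (rule M)
  have spM: "space M = UNIV"
    using sets_eq_imp_space_eq[OF sets_M] by simp
  have ev: "eventually (\<lambda>k. integrable (\<mu> (r k)) (mon_val \<alpha>)) sequentially" for \<alpha>
    by (rule eventually_subseq[OF r int])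
  have lim': "(\<lambda>k. integral\<^sup>L (\<mu> (r k)) (mon_val \<alpha>)) \<longlonglongrightarrow> s \<alpha>" for \<alpha>
    using LIMSEQ_subseq_LIMSEQ[OF lim r] by (simp add: comp_def)
  have sq: "(\<lambda>x. mon_val \<alpha> x * mon_val \<alpha> x) = mon_val (\<alpha> + \<alpha>)" for \<alpha> :: "'n \<Rightarrow> nat"
    by (auto simp: mon_val_add)
  \<comment> \<open>Monomials of index \<open>\<alpha> + \<alpha>\<close> are squares, so a cut-off
    from above makes them bounded and continuous. Their limit integrals stay below
    \<open>s (\<alpha> + \<alpha>)\<close>, and letting the cut-off grow gives a Fatou-type bound
    under \<open>M\<close>.\<close>
  have square: "integrable M (mon_val (\<alpha> + \<alpha>))" "integral\<^sup>L M (mon_val (\<alpha> + \<alpha>)) \<le> s (\<alpha> + \<alpha>)" for \<alpha>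
  proof -
    have bound: "integral\<^sup>L M (\<lambda>x. min R (mon_val (\<alpha> + \<alpha>) x)) \<le> s (\<alpha> + \<alpha>)" if "R > 0" for R
    proof (rule LIMSEQ_le[OF conv lim'])
      show "continuous_on UNIV (\<lambda>x. min R (mon_val (\<alpha> + \<alpha>) x))"
        by (intro continuous_intros continuous_on_mon_val)
      show "bounded (range (\<lambda>x. min R (mon_val (\<alpha> + \<alpha>) x)))"
        using that by (auto simp: bounded_iff mon_val_add min_def intro!: exI[of _ R])
      obtain N where N: "\<And>k. k \<ge> N \<Longrightarrow> integrable (\<mu> (r k)) (mon_val (\<alpha> + \<alpha>))"
        using ev by (auto simp: eventually_sequentially)
      show "\<exists>N. \<forall>k\<ge>N. integral\<^sup>L (\<mu> (r k)) (\<lambda>x. min R (mon_val (\<alpha> + \<alpha>) x))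
            \<le> integral\<^sup>L (\<mu> (r k)) (mon_val (\<alpha> + \<alpha>))"
        by (intro exI[of _ N] allI impI integral_mono N) (use N in auto)
    qed
    note * = integrable_of_bounded_truncations[OF M.finite_measure_axioms _ _ bound]
    show "integrable M (mon_val (\<alpha> + \<alpha>))" "integral\<^sup>L M (mon_val (\<alpha> + \<alpha>)) \<le> s (\<alpha> + \<alpha>)"
      by (rule *; simp add: mon_val_add)+
  qed
  have integ: "integrable M (mon_val \<alpha>)" for \<alpha>
    by (rule truncation_error(1)[OF M.finite_measure_axioms, of _ 1])
       (use square(1)[of \<alpha>] in \<open>auto simp: sq\<close>)
  have val: "integral\<^sup>L M (mon_val \<alpha>) = s \<alpha>" for \<alpha>
  proof -
    define u where "u = mon_val \<alpha>"
    define C where "C = s (\<alpha> + \<alpha>)"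
    have main: "\<bar>integral\<^sup>L M u - s \<alpha>\<bar> \<le> \<epsilon> * (2 * C)" if "\<epsilon> > 0" for \<epsilon>
    proof -
      \<comment> \<open>With this level each of the two truncation errors, under \<open>M\<close>
        and in the limit of the subsequence, is at most \<open>\<epsilon> * C\<close>.\<close>
      define R where "R = 1 / \<epsilon>"
      have R: "R > 0" using that by (simp add: R_def)
      define t where "t x = max (-R) (min R (u x))" for x
      have "continuous_on UNIV t"
        unfolding t_def u_def by (intro continuous_intros continuous_on_mon_val)
      moreover have "bounded (range t)"
        using R by (auto simp: bounded_iff t_def max_def min_def intro!: exI[of _ R])
      ultimately have t_lim: "(\<lambda>k. integral\<^sup>L (\<mu> (r k)) t) \<longlonglongrightarrow> integral\<^sup>L M t"
        by (rule conv)
      have M_err: "\<bar>integral\<^sup>L M u - integral\<^sup>L M t\<bar> \<le> C / R"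
      proof -
        have "\<bar>integral\<^sup>L M u - integral\<^sup>L M t\<bar> \<le> integral\<^sup>L M (\<lambda>x. u x * u x) / R"
          unfolding t_def using square(1)[of \<alpha>] R
          by (intro truncation_error(2) M.finite_measure_axioms) (auto simp: u_def sq)
        also have "\<dots> \<le> C / R"
          using square(2)[of \<alpha>] R by (intro divide_right_mono) (auto simp: u_def sq C_def)
        finally show ?thesis .
      qed
      \<comment> \<open>Pass to the limit in the triangle inequality: the truncated integrals
        converge, so only the limit \<open>C / R\<close> of the truncation errors remains.\<close>
      have "(\<lambda>k. \<bar>integral\<^sup>L M t - integral\<^sup>L (\<mu> (r k)) u\<bar>) \<longlonglongrightarrow> \<bar>integral\<^sup>L M t - s \<alpha>\<bar>"
        unfolding u_def by (intro tendsto_intros lim')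
      moreover have "(\<lambda>k. \<bar>integral\<^sup>L M t - integral\<^sup>L (\<mu> (r k)) t\<bar>
            + integral\<^sup>L (\<mu> (r k)) (mon_val (\<alpha> + \<alpha>)) / R) \<longlonglongrightarrow> \<bar>integral\<^sup>L M t - integral\<^sup>L M t\<bar> + C / R"
        unfolding C_def using R by (intro tendsto_intros lim' t_lim) auto
      moreover have "eventually (\<lambda>k. \<bar>integral\<^sup>L M t - integral\<^sup>L (\<mu> (r k)) u\<bar>
          \<le> \<bar>integral\<^sup>L M t - integral\<^sup>L (\<mu> (r k)) t\<bar>
            + integral\<^sup>L (\<mu> (r k)) (mon_val (\<alpha> + \<alpha>)) / R) sequentially"
        using ev[of "\<alpha> + \<alpha>"]
      proof eventually_elim
        case (elim k)
        have "\<bar>integral\<^sup>L (\<mu> (r k)) u - integral\<^sup>L (\<mu> (r k)) t\<bar>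
            \<le> integral\<^sup>L (\<mu> (r k)) (\<lambda>x. u x * u x) / R"
          unfolding t_def using elim R
          by (intro truncation_error(2) \<mu>.finite_measure_axioms) (auto simp: u_def sq)
        thus ?case by (simp add: u_def sq)
      qed
      ultimately have "\<bar>integral\<^sup>L M t - s \<alpha>\<bar> \<le> \<bar>integral\<^sup>L M t - integral\<^sup>L M t\<bar> + C / R"
        by (intro tendsto_le[OF sequentially_bot])
      with M_err have "\<bar>integral\<^sup>L M u - s \<alpha>\<bar> \<le> C / R + C / R" by linarith
      thus ?thesis by (simp add: R_def algebra_simps)
    qed
    have "integral\<^sup>L M u - s \<alpha> = 0" by (rule abs_le_by_eps[OF main])
    thus ?thesis by (simp add: u_def)
  qed
  have "emeasure M (UNIV - K) = 0"
  proof -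
    have AE_K: "AE x in \<mu> k. x \<in> K" for k
      by (rule AE_I[where N = "UNIV - K"]) (use supp K in \<open>auto simp: sp sets_\<mu> borel_closed\<close>)
    \<comment> \<open>Nonemptiness matters because \<open>infdist\<close> to the empty set is 0 by
      convention and would detect nothing.\<close>
    have "K \<noteq> {}"
      using AE_K[of 0] \<mu>.AE_False by auto
    \<comment> \<open>A bounded continuous function whose zero set is exactly the closed set
      \<open>K\<close>: its integrals vanish along the sequence, hence under
      \<open>M\<close>.\<close>
    define f where "f x = min 1 (infdist x K)" for x
    have f_cont: "continuous_on UNIV f"
      unfolding f_def by (intro continuous_intros)
    hence [measurable]: "f \<in> borel_measurable borel"
      by (rule borel_measurable_continuous_onI)
    have f_range: "0 \<le> f x" "f x \<le> 1" for x by (auto simp: f_def infdist_nonneg)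
    have "integral\<^sup>L (\<mu> k) f = 0" for k
      by (rule integral_eq_zero_AE) (use AE_K[of k] in \<open>auto simp: f_def elim!: eventually_mono\<close>)
    moreover have "(\<lambda>k. integral\<^sup>L (\<mu> (r k)) f) \<longlonglongrightarrow> integral\<^sup>L M f"
      by (rule conv[OF f_cont]) (use f_range in \<open>auto simp: bounded_iff intro!: exI[of _ 1]\<close>)
    ultimately have "integral\<^sup>L M f = 0" by (simp add: LIMSEQ_const_iff)
    moreover have "integrable M f"
      by (rule M.integrable_const_bound[of _ 1]) (use f_range in auto)
    ultimately have "AE x in M. f x = 0"
      using integral_nonneg_eq_0_iff_AE[of M f] f_range by auto
    hence "AE x in M. x \<in> K"
    proof eventually_elim
      case (elim x)
      hence "infdist x K = 0" by (auto simp: f_def min_def split: if_splits)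
      thus ?case using in_closed_iff_infdist_zero[OF K \<open>K \<noteq> {}\<close>] by simp
    qed
    moreover have "{x \<in> space M. x \<notin> K} = UNIV - K" by (auto simp: spM)
    moreover have "UNIV - K \<in> sets M" using K by (simp add: sets_M borel_closed)
    ultimately show ?thesis using AE_iff_measurable[of "UNIV - K" M "\<lambda>x. x \<in> K"] by simp
  qed
  from that[OF M sets_M this integ val] show thesis .
qed

text \<open>Dividing by the total masses reduces to probability measures when the limit mass
  \<open>s (\<lambda>_. 0)\<close> is positive. When it is zero, all limit moments vanish and the
  zero measure represents them.\<close>

lemma is_moment_seqI_limit:
  fixes \<mu> :: "nat \<Rightarrow> (real^'n::finite) measure" and K :: "(real^'n) set"
  assumes sets_\<mu>[measurable_cong]: "\<And>k. sets (\<mu> k) = sets borel"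
    and K: "closed K" and supp: "\<And>k. emeasure (\<mu> k) (UNIV - K) = 0"
    and int: "\<And>\<alpha>. eventually (\<lambda>k. integrable (\<mu> k) (mon_val \<alpha>)) sequentially"
    and lim: "\<And>\<alpha>. (\<lambda>k. integral\<^sup>L (\<mu> k) (mon_val \<alpha>)) \<longlonglongrightarrow> s \<alpha>"
  shows "is_moment_seq K s"
proof -
  have sp: "space (\<mu> k) = UNIV" for k
    using sets_eq_imp_space_eq[OF sets_\<mu>] by simp
  \<comment> \<open>If \<open>\<mu> k\<close> has infinite mass, this integral takes the default
    value 0, so \<open>m k\<close> is nonnegative for every \<open>k\<close>.\<close>
  define m where "m k = integral\<^sup>L (\<mu> k) (mon_val (\<lambda>_. 0))" for k
  have m_nonneg: "m k \<ge> 0" for k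
    by (simp add: m_def mon_val_0[abs_def])
  have m_lim: "m \<longlonglongrightarrow> s (\<lambda>_. 0)"
    using lim[of "\<lambda>_. 0"] by (simp add: m_def[abs_def])
  have s0: "s (\<lambda>_. 0) \<ge> 0"
    using m_lim m_nonneg by (auto intro: LIMSEQ_le_const)
  show ?thesis
  proof (cases "s (\<lambda>_. 0) = 0")
    case True
    \<comment> \<open>Integrate \<open>abs_le_eps_square\<close> and pass to the limit: the mass
      term disappears, leaving a bound proportional to the arbitrary
      \<open>\<epsilon>\<close>.\<close>
    have "s \<alpha> = 0" for \<alpha>
    proof (rule abs_le_by_eps)
      fix \<epsilon> :: real assume "\<epsilon> > 0"
      have sq: "mon_val (\<alpha> + \<alpha>) x = mon_val \<alpha> x * mon_val \<alpha> x" for x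
        by (simp add: mon_val_add)
      have "(\<lambda>k. \<bar>integral\<^sup>L (\<mu> k) (mon_val \<alpha>)\<bar>) \<longlonglongrightarrow> \<bar>s \<alpha>\<bar>"
        by (intro tendsto_intros lim)
      moreover have "(\<lambda>k. \<epsilon> * integral\<^sup>L (\<mu> k) (mon_val (\<alpha> + \<alpha>)) + inverse \<epsilon> * m k)
          \<longlonglongrightarrow> \<epsilon> * s (\<alpha> + \<alpha>) + inverse \<epsilon> * s (\<lambda>_. 0)"
        by (intro tendsto_intros lim m_lim)
      moreover have "eventually (\<lambda>k. \<bar>integral\<^sup>L (\<mu> k) (mon_val \<alpha>)\<bar>
          \<le> \<epsilon> * integral\<^sup>L (\<mu> k) (mon_val (\<alpha> + \<alpha>)) + inverse \<epsilon> * m k) sequentially"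
        using int[of \<alpha>] int[of "\<alpha> + \<alpha>"] int[of "\<lambda>_. 0"]
      proof eventually_elim
        case (elim k)
        have "\<bar>integral\<^sup>L (\<mu> k) (mon_val \<alpha>)\<bar> \<le> integral\<^sup>L (\<mu> k) (\<lambda>x. \<bar>mon_val \<alpha> x\<bar>)"
          by (rule integral_abs_bound)
        also have "\<dots> \<le> integral\<^sup>L (\<mu> k) (\<lambda>x. \<epsilon> * mon_val (\<alpha> + \<alpha>) x + inverse \<epsilon> * mon_val (\<lambda>_. 0) x)"
          by (intro integral_mono Bochner_Integration.integrable_add integrable_mult_right integrable_abs elim)
            (use abs_le_eps_square[OF \<open>\<epsilon> > 0\<close>] in \<open>simp add: sq mon_val_0\<close>)
        finally show ?case using elim by (simp add: m_def)
      qed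
      ultimately have "\<bar>s \<alpha>\<bar> \<le> \<epsilon> * s (\<alpha> + \<alpha>) + inverse \<epsilon> * s (\<lambda>_. 0)"
        by (intro tendsto_le[OF sequentially_bot])
      thus "\<bar>s \<alpha>\<bar> \<le> \<epsilon> * s (\<alpha> + \<alpha>)" using True by simp
    qed
    thus ?thesis
      unfolding is_moment_seq_def by (intro exI[of _ "null_measure borel"]) (auto simp: integrable_null_measure_iff)
  next
    case False
    hence pos: "s (\<lambda>_. 0) > 0" using s0 by simp
    \<comment> \<open>The shift by \<open>N\<close> discards measures that cannot be normalised or
      lack second moments; these moments are finitely many, so one \<open>N\<close> serves
      all.\<close>
    have "eventually (\<lambda>k. m k > 0 \<and> integrable (\<mu> k) (mon_val (\<lambda>_. 0))
        \<and> (\<forall>i. integrable (\<mu> k) (mon_val (\<lambda>j. if j = i then 2 else 0)))) sequentially"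
      by (intro eventually_conj order_tendstoD(1)[OF m_lim pos] int eventually_all_finite)
    then obtain N where N: "\<And>k. k \<ge> N \<Longrightarrow> m k > 0" "\<And>k. k \<ge> N \<Longrightarrow> integrable (\<mu> k) (mon_val (\<lambda>_. 0))"
      "\<And>k i. k \<ge> N \<Longrightarrow> integrable (\<mu> k) (mon_val (\<lambda>j. if j = i then 2 else 0))"
      by (auto simp: eventually_sequentially)
    define \<rho> where "\<rho> k = density (\<mu> (k + N)) (\<lambda>_. ennreal (1 / m (k + N)))" for k
    have sets_\<rho>: "sets (\<rho> k) = sets borel" for k by (simp add: \<rho>_def sets_\<mu>)
    have mpos: "m (k + N) > 0" for k by (rule N(1)) simp
    have \<rho>_int: "integral\<^sup>L (\<rho> k) f = integral\<^sup>L (\<mu> (k + N)) f / m (k + N)"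
      if [measurable]: "f \<in> borel_measurable borel" for f :: "real^'n \<Rightarrow> real" and k
      unfolding \<rho>_def using mpos[of k] by (subst integral_density) (auto simp: less_imp_le)
    have \<rho>_integrable: "integrable (\<rho> k) f \<longleftrightarrow> integrable (\<mu> (k + N)) f"
      if [measurable]: "f \<in> borel_measurable borel" for f :: "real^'n \<Rightarrow> real" and k
      unfolding \<rho>_def using mpos[of k] by (subst integrable_density) (auto simp: less_imp_le divide_inverse)
    have prob: "prob_space (\<rho> k)" for k
    proof
      have "integrable (\<mu> (k + N)) (\<lambda>_. 1::real)"
        using N(2)[of "k + N"] by (simp add: mon_val_0[abs_def])
      from nn_integral_eq_integral[OF this] have "emeasure (\<mu> (k + N)) UNIV = ennreal (m (k + N))"
        by (simp add: m_def mon_val_0[abs_def] sp)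
      thus "emeasure (\<rho> k) (space (\<rho> k)) = 1"
        using mpos[of k] unfolding \<rho>_def
        by (simp add: emeasure_density_const sp sets_\<mu> ennreal_mult'[symmetric])
    qed
    have supp_\<rho>: "emeasure (\<rho> k) (UNIV - K) = 0" for k
      unfolding \<rho>_def using K supp by (subst emeasure_density_const) (auto simp: sets_\<mu> borel_closed)
    have int_\<rho>: "eventually (\<lambda>k. integrable (\<rho> k) (mon_val \<alpha>)) sequentially" for \<alpha>
      using sequentially_offset[OF int[of \<alpha>], of N] by (simp add: \<rho>_integrable)
    have int2_\<rho>: "integrable (\<rho> k) (\<lambda>x. (x $ i)\<^sup>2)" for k i
      using N(3)[of "k + N" i] by (simp add: \<rho>_integrable[symmetric] mon_val_square[abs_def])
    have lim_\<rho>: "(\<lambda>k. integral\<^sup>L (\<rho> k) (mon_val \<alpha>)) \<longlonglongrightarrow> s \<alpha> / s (\<lambda>_. 0)" for \<alpha>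
      using False unfolding \<rho>_int[OF measurable_mon_val]
      by (intro tendsto_divide LIMSEQ_ignore_initial_segment[OF lim] LIMSEQ_ignore_initial_segment[OF m_lim])
    obtain M where M: "prob_space M" and sets_M[measurable_cong]: "sets M = sets borel"
      and M': "emeasure M (UNIV - K) = 0" "\<And>\<alpha>. integrable M (mon_val \<alpha>)"
      "\<And>\<alpha>. integral\<^sup>L M (mon_val \<alpha>) = s \<alpha> / s (\<lambda>_. 0)"
      by (rule prob_limit_of_moments[OF prob sets_\<rho> K supp_\<rho> int_\<rho> int2_\<rho> lim_\<rho>]) blast
    define \<nu> where "\<nu> = density M (\<lambda>_. ennreal (s (\<lambda>_. 0)))"
    have "sets \<nu> = sets borel" by (simp add: \<nu>_def sets_M)
    moreover have "emeasure \<nu> (UNIV - K) = 0"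
      unfolding \<nu>_def using K M'(1) by (subst emeasure_density_const) (auto simp: sets_M borel_closed)
    moreover have "integrable \<nu> (mon_val \<alpha>)" for \<alpha>
      unfolding \<nu>_def using M'(2)[of \<alpha>] s0 by (subst integrable_density) auto
    moreover have "integral\<^sup>L \<nu> (mon_val \<alpha>) = s \<alpha>" for \<alpha>
      unfolding \<nu>_def using M'(3)[of \<alpha>] pos by (subst integral_density) auto
    ultimately show ?thesis unfolding is_moment_seq_def by metis
  qed
qed

section \<open>Mixtures of measures\<close>

text \<open>The index space carries the power set as its sigma-algebra, so that a family of measures
  indexed by it is automatically a kernel.\<close>

definition mixture :: "'i measure \<Rightarrow> ('i \<Rightarrow> 'a measure) \<Rightarrow> 'a::topological_space measure" where
  "mixture \<kappa> N = measure_of UNIV (sets borel) (\<lambda>A. \<integral>\<^sup>+ i. emeasure (N i) A \<partial>\<kappa>)"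

context
  fixes \<kappa> :: "'i measure" and N :: "'i \<Rightarrow> 'a::topological_space measure"
  assumes sets_\<kappa>: "sets \<kappa> = UNIV" and sets_N: "\<And>i. sets (N i) = sets borel"
begin

lemma measurable_index: "f \<in> measurable \<kappa> M" if "\<And>i. f i \<in> space M"
  using that by (auto simp: measurable_def sets_\<kappa>)

lemma sets_mixture: "sets (mixture \<kappa> N) = sets borel"
  unfolding mixture_def using sets.sigma_sets_eq[of borel] by (subst sets_measure_of) auto

lemma emeasure_mixture:
  assumes "A \<in> sets borel"
  shows "emeasure (mixture \<kappa> N) A = (\<integral>\<^sup>+ i. emeasure (N i) A \<partial>\<kappa>)"
proof (rule emeasure_measure_of[OF mixture_def])
  show "countably_additive (sets (mixture \<kappa> N)) (\<lambda>A. \<integral>\<^sup>+ i. emeasure (N i) A \<partial>\<kappa>)"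
  proof (rule countably_additiveI)
    fix A :: "nat \<Rightarrow> 'a set"
    assume A: "range A \<subseteq> sets (mixture \<kappa> N)" "disjoint_family A"
    have "suminf (\<lambda>n. \<integral>\<^sup>+ i. emeasure (N i) (A n) \<partial>\<kappa>) = (\<integral>\<^sup>+ i. suminf (\<lambda>n. emeasure (N i) (A n)) \<partial>\<kappa>)"
      by (intro nn_integral_suminf[symmetric] measurable_index) simp
    also have "\<dots> = (\<integral>\<^sup>+ i. emeasure (N i) (\<Union>n. A n) \<partial>\<kappa>)"
      using A by (intro nn_integral_cong suminf_emeasure) (auto simp: sets_mixture sets_N)
    finally show "suminf (\<lambda>n. \<integral>\<^sup>+ i. emeasure (N i) (A n) \<partial>\<kappa>) = (\<integral>\<^sup>+ i. emeasure (N i) (\<Union>n. A n) \<partial>\<kappa>)" .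
  qed
qed (use assms in \<open>auto simp: sets_mixture positive_def\<close>)

text \<open>Induction over nonnegative Borel functions: the defining formula settles indicators,
  linearity and monotone convergence the rest. Inner integrals are measurable because every function
  of the index is.\<close>

lemma nn_integral_mixture:
  assumes "f \<in> borel_measurable borel"
  shows "(\<integral>\<^sup>+ x. f x \<partial>mixture \<kappa> N) = (\<integral>\<^sup>+ i. \<integral>\<^sup>+ x. f x \<partial>N i \<partial>\<kappa>)"
proof -
  have sp: "space (N i) = UNIV" "space (mixture \<kappa> N) = UNIV" for i
    using sets_eq_imp_space_eq[OF sets_N] sets_eq_imp_space_eq[OF sets_mixture] by simp_all
  note meas = measurable_cong_sets[OF sets_N refl] measurable_cong_sets[OF sets_mixture refl]
  show ?thesis using assms
  proof (induction rule: borel_measurable_induct)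
    case (cong f g)
    thus ?case by (simp add: fun_eq_iff[symmetric])
  next
    case (set A)
    thus ?case by (simp add: emeasure_mixture sets_N sets_mixture)
  next
    case (mult u c)
    thus ?case by (simp add: nn_integral_cmult meas measurable_index)
  next
    case (add u v)
    thus ?case by (simp add: nn_integral_add meas measurable_index)
  next
    case (seq U)
    have "(\<integral>\<^sup>+ x. (SUP i. U i) x \<partial>mixture \<kappa> N) = (SUP k. \<integral>\<^sup>+ x. U k x \<partial>mixture \<kappa> N)"
      unfolding SUP_apply using seq by (intro nn_integral_monotone_convergence_SUP) (auto simp: meas)
    also have "\<dots> = (SUP k. \<integral>\<^sup>+ i. \<integral>\<^sup>+ x. U k x \<partial>N i \<partial>\<kappa>)"
      using seq by simp
    also have "\<dots> = (\<integral>\<^sup>+ i. (SUP k. \<integral>\<^sup>+ x. U k x \<partial>N i) \<partial>\<kappa>)"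
      using seq by (intro nn_integral_monotone_convergence_SUP[symmetric] measurable_index)
        (auto simp: incseq_def le_fun_def intro!: nn_integral_mono)
    also have "\<dots> = (\<integral>\<^sup>+ i. \<integral>\<^sup>+ x. (SUP i. U i) x \<partial>N i \<partial>\<kappa>)"
      unfolding SUP_apply using seq
      by (intro nn_integral_cong nn_integral_monotone_convergence_SUP[symmetric]) (auto simp: meas)
    finally show ?case .
  qed
qed

text \<open>\<open>u\<close> is the difference of the nonnegative functions
  \<open>\<bar>u\<bar> + u\<close> and \<open>\<bar>u\<bar>\<close>, both at most
  \<open>2 * \<bar>u\<bar>\<close>. For such functions \<open>nn_integral_mixture\<close> applies,
  and \<open>fin\<close> keeps the iterated integrals finite.\<close>

lemma integral_mixture:
  fixes u :: "'a \<Rightarrow> real"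
  assumes u: "u \<in> borel_measurable borel" and u_int: "\<And>i. integrable (N i) u"
    and fin: "integrable \<kappa> (\<lambda>i. \<integral>x. \<bar>u x\<bar> \<partial>N i)"
  shows "integrable (mixture \<kappa> N) u"
    and "(\<integral>x. u x \<partial>mixture \<kappa> N) = (\<integral>i. \<integral>x. u x \<partial>N i \<partial>\<kappa>)"
proof -
  note meas = measurable_cong_sets[OF sets_N refl] measurable_cong_sets[OF sets_mixture refl]
  have nonneg: "integrable (mixture \<kappa> N) f \<and> (\<integral>x. f x \<partial>mixture \<kappa> N) = (\<integral>i. \<integral>x. f x \<partial>N i \<partial>\<kappa>)
      \<and> integrable \<kappa> (\<lambda>i. \<integral>x. f x \<partial>N i)"
    if f: "f \<in> borel_measurable borel" "\<And>x. f x \<ge> 0" "\<And>x. f x \<le> 2 * \<bar>u x\<bar>" for f :: "'a \<Rightarrow> real"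
  proof -
    have f_int: "integrable (N i) f" for i
      using f u_int[of i] by (intro Bochner_Integration.integrable_bound[of _ "\<lambda>x. 2 * \<bar>u x\<bar>" f]) (auto simp: meas)
    have "integrable \<kappa> (\<lambda>i. \<integral>x. f x \<partial>N i)"
    proof (rule Bochner_Integration.integrable_bound[of _ "\<lambda>i. 2 * (\<integral>x. \<bar>u x\<bar> \<partial>N i)"])
      have "(\<integral>x. f x \<partial>N i) \<le> (\<integral>x. 2 * \<bar>u x\<bar> \<partial>N i)" for i
        using f f_int u_int by (intro integral_mono) auto
      thus "AE i in \<kappa>. norm (\<integral>x. f x \<partial>N i) \<le> norm (2 * (\<integral>x. \<bar>u x\<bar> \<partial>N i))"
        using f(2) by (auto intro!: AE_I2 simp: integral_nonneg_AE)
    qed (use fin in \<open>auto intro: measurable_index\<close>)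
    moreover have eq: "(\<integral>\<^sup>+ x. ennreal (f x) \<partial>mixture \<kappa> N) = ennreal (\<integral>i. \<integral>x. f x \<partial>N i \<partial>\<kappa>)"
    proof -
      have "(\<integral>\<^sup>+ x. ennreal (f x) \<partial>mixture \<kappa> N) = (\<integral>\<^sup>+ i. \<integral>\<^sup>+ x. ennreal (f x) \<partial>N i \<partial>\<kappa>)"
        by (rule nn_integral_mixture) (use f in measurable)
      also have "\<dots> = (\<integral>\<^sup>+ i. ennreal (\<integral>x. f x \<partial>N i) \<partial>\<kappa>)"
        using f f_int by (intro nn_integral_cong nn_integral_eq_integral) auto
      also have "\<dots> = ennreal (\<integral>i. \<integral>x. f x \<partial>N i \<partial>\<kappa>)"
        using calculation f(2) \<open>integrable \<kappa> (\<lambda>i. \<integral>x. f x \<partial>N i)\<close>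
        by (intro nn_integral_eq_integral) auto
      finally show ?thesis .
    qed
    ultimately show ?thesis
      using integrableI_nn_integral_finite[OF _ _ eq] integral_eq_nn_integral[of f "mixture \<kappa> N"] f
      by (auto simp: meas integral_nonneg_AE)
  qed
  have 1: "integrable (mixture \<kappa> N) (\<lambda>x. \<bar>u x\<bar> + u x)"
    "(\<integral>x. \<bar>u x\<bar> + u x \<partial>mixture \<kappa> N) = (\<integral>i. \<integral>x. \<bar>u x\<bar> + u x \<partial>N i \<partial>\<kappa>)"
    "integrable \<kappa> (\<lambda>i. \<integral>x. \<bar>u x\<bar> + u x \<partial>N i)"
    using nonneg[of "\<lambda>x. \<bar>u x\<bar> + u x"] u by (auto simp: abs_if)
  have 2: "integrable (mixture \<kappa> N) (\<lambda>x. \<bar>u x\<bar>)"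
    "(\<integral>x. \<bar>u x\<bar> \<partial>mixture \<kappa> N) = (\<integral>i. \<integral>x. \<bar>u x\<bar> \<partial>N i \<partial>\<kappa>)"
    "integrable \<kappa> (\<lambda>i. \<integral>x. \<bar>u x\<bar> \<partial>N i)"
    using nonneg[of "\<lambda>x. \<bar>u x\<bar>"] u by auto
  show "integrable (mixture \<kappa> N) u"
    using Bochner_Integration.integrable_diff[OF 1(1) 2(1)] by simp
  have "(\<integral>x. u x \<partial>mixture \<kappa> N) = (\<integral>x. \<bar>u x\<bar> + u x \<partial>mixture \<kappa> N) - (\<integral>x. \<bar>u x\<bar> \<partial>mixture \<kappa> N)"
    using Bochner_Integration.integral_diff[OF 1(1) 2(1)] by simp
  also have "\<dots> = (\<integral>i. (\<integral>x. \<bar>u x\<bar> + u x \<partial>N i) - (\<integral>x. \<bar>u x\<bar> \<partial>N i) \<partial>\<kappa>)"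
    unfolding 1(2) 2(2) by (rule Bochner_Integration.integral_diff[OF 1(3) 2(3), symmetric])
  also have "\<dots> = (\<integral>i. \<integral>x. u x \<partial>N i \<partial>\<kappa>)"
    using u_int by (intro Bochner_Integration.integral_cong refl) simp
  finally show "(\<integral>x. u x \<partial>mixture \<kappa> N) = (\<integral>i. \<integral>x. u x \<partial>N i \<partial>\<kappa>)" .
qed

end

section \<open>Averages of moment sequences\<close>

text \<open>Each cell meeting \<open>K\<close> receives the measure of one representative point. The
  mixture weighted by the \<open>\<nu>\<close>-mass of the cells has as moments the integrals of
  step functions close to \<open>P \<alpha>\<close>, so these moments converge to the averages and
  \<open>is_moment_seqI_limit\<close> applies.\<close>

lemma is_moment_seq_average:
  fixes K :: "(real^'n::finite) set" and P :: "('n \<Rightarrow> nat) \<Rightarrow> real^'n \<Rightarrow> real"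
  assumes K: "closed K" and \<nu>: "finite_measure \<nu>" and sets_\<nu>[measurable_cong]: "sets \<nu> = sets borel"
    and supp: "emeasure \<nu> (UNIV - K) = 0"
    and P[measurable]: "\<And>\<alpha>. P \<alpha> \<in> borel_measurable borel" and P_int: "\<And>\<alpha>. integrable \<nu> (P \<alpha>)"
    and mom: "\<And>y. y \<in> K \<Longrightarrow> is_moment_seq K (\<lambda>\<alpha>. P \<alpha> y)"
  shows "is_moment_seq K (\<lambda>\<alpha>. \<integral>y. P \<alpha> y \<partial>\<nu>)"
proof -
  interpret \<nu>: finite_measure \<nu> by (rule \<nu>)
  have sp: "space \<nu> = UNIV" using sets_eq_imp_space_eq[OF sets_\<nu>] by simp
  have AE_K: "AE x in \<nu>. x \<in> K"
    by (rule AE_I[where N = "UNIV - K"]) (use supp K in \<open>auto simp: sp sets_\<nu> borel_closed\<close>)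
  have "\<forall>y\<in>K. \<exists>N::(real^'n) measure. sets N = sets borel \<and> emeasure N (UNIV - K) = 0 \<and>
      (\<forall>\<alpha>. integrable N (mon_val \<alpha>) \<and> P \<alpha> y = integral\<^sup>L N (mon_val \<alpha>))"
    using mom by (auto simp: is_moment_seq_def)
  then obtain N :: "real^'n \<Rightarrow> (real^'n) measure" where N: "\<And>y. y \<in> K \<Longrightarrow> sets (N y) = sets borel"
    "\<And>y. y \<in> K \<Longrightarrow> emeasure (N y) (UNIV - K) = 0"
    "\<And>y \<alpha>. y \<in> K \<Longrightarrow> integrable (N y) (mon_val \<alpha>)"
    "\<And>y \<alpha>. y \<in> K \<Longrightarrow> integral\<^sup>L (N y) (mon_val \<alpha>) = P \<alpha> y"
    by metis
  \<comment> \<open>The cells of \<open>idx k\<close> are chosen so that the first \<open>k\<close> of the functions \<open>P \<alpha>\<close> vary by at most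
    \<open>1 / (k + 1)\<close> on each of them; no smallness of the cells in space is needed.\<close>
  define idx :: "nat \<Rightarrow> real^'n \<Rightarrow> nat" where
    "idx k x = to_nat (map (\<lambda>j. \<lfloor>real (Suc k) * P (from_nat j) x\<rfloor>) [0..<k])" for k x
  have [measurable]: "idx k \<in> measurable \<nu> (count_space UNIV)" for k
  proof -
    have "idx k -` {i} \<inter> space \<nu> \<in> sets \<nu>" for i
    proof (cases "\<exists>y. idx k y = i")
      case True
      then obtain y where y: "idx k y = i" by blast
      have "idx k -` {i} \<inter> space \<nu> = {x \<in> space \<nu>. \<forall>j\<in>{0..<k}.
          \<lfloor>real (Suc k) * P (from_nat j) x\<rfloor> = \<lfloor>real (Suc k) * P (from_nat j) y\<rfloor>}"
        by (auto simp: y[symmetric] idx_def)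
      also have "\<dots> \<in> sets \<nu>" by measurable
      finally show ?thesis .
    next
      case False
      hence "idx k -` {i} \<inter> space \<nu> = {}" by auto
      thus ?thesis by simp
    qed
    thus ?thesis by (subst measurable_count_space_eq_countable) auto
  qed
  define pick where "pick k i = (SOME y. y \<in> K \<and> idx k y = i)" for k i
  have pick: "pick k i \<in> K" "idx k (pick k i) = i" if "\<exists>y\<in>K. idx k y = i" for k i
    using someI_ex[of "\<lambda>y. y \<in> K \<and> idx k y = i"] that by (auto simp: pick_def)
  \<comment> \<open>A cell that misses \<open>K\<close> is \<open>\<nu>\<close>-null. Giving it the
    zero measure makes every \<open>N' k i\<close> a measure carried by \<open>K\<close> with all
    moments.\<close>
  define N' where "N' k i = (if \<exists>y\<in>K. idx k y = i then N (pick k i) else null_measure borel)" for k i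
  define F where "F k \<alpha> i = (if \<exists>y\<in>K. idx k y = i then P \<alpha> (pick k i) else 0)" for k \<alpha> i
  have sets_N': "sets (N' k i) = sets borel" for k i
    by (auto simp: N'_def N(1) pick)
  have supp_N': "emeasure (N' k i) (UNIV - K) = 0" for k i
    by (auto simp: N'_def N(2) pick)
  have int_N': "integrable (N' k i) (mon_val \<alpha>)" for k i \<alpha>
    by (auto simp: N'_def N(3) pick integrable_null_measure_iff)
  have val_N': "integral\<^sup>L (N' k i) (mon_val \<alpha>) = F k \<alpha> i" for k i \<alpha>
    by (auto simp: N'_def F_def N(4) pick)
  \<comment> \<open>\<open>to_nat \<alpha> < k\<close> says that \<open>P \<alpha>\<close> is among
    the functions defining the cells; equal floors after scaling by \<open>Suc k\<close> bound the
    difference by \<open>1 / real (Suc k)\<close>.\<close>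
  have F_close: "\<bar>F k \<alpha> (idx k x) - P \<alpha> x\<bar> \<le> 1 / real (Suc k)"
    if "x \<in> K" "to_nat \<alpha> < k" for k \<alpha> x
  proof -
    have ex: "\<exists>y\<in>K. idx k y = idx k x" using that by blast
    define y where "y = pick k (idx k x)"
    have "idx k y = idx k x" unfolding y_def by (rule pick(2)[OF ex])
    hence "\<forall>j\<in>{0..<k}. \<lfloor>real (Suc k) * P (from_nat j) y\<rfloor> = \<lfloor>real (Suc k) * P (from_nat j) x\<rfloor>"
      by (simp add: idx_def)
    hence "\<lfloor>real (Suc k) * P \<alpha> y\<rfloor> = \<lfloor>real (Suc k) * P \<alpha> x\<rfloor>"
      using that(2) by (auto dest: bspec[of _ _ "to_nat \<alpha>"])
    hence "\<bar>real (Suc k) * P \<alpha> y - real (Suc k) * P \<alpha> x\<bar> \<le> 1" by linarith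
    hence "\<bar>real (Suc k) * (P \<alpha> y - P \<alpha> x)\<bar> \<le> 1" by (simp only: right_diff_distrib)
    hence "\<bar>P \<alpha> y - P \<alpha> x\<bar> * real (Suc k) \<le> 1" by (simp add: abs_mult mult.commute)
    thus ?thesis using ex by (simp add: F_def y_def pos_le_divide_eq)
  qed
  have F_meas: "(\<lambda>x. F k \<alpha> (idx k x)) \<in> borel_measurable \<nu>" for k \<alpha>
    by (rule measurable_compose[of "idx k" \<nu> "count_space UNIV"]) auto
  have F_int: "integrable \<nu> (\<lambda>x. F k \<alpha> (idx k x))" if "to_nat \<alpha> < k" for k \<alpha>
  proof (rule Bochner_Integration.integrable_bound[OF _ F_meas])
    show "integrable \<nu> (\<lambda>x. \<bar>P \<alpha> x\<bar> + 1 / real (Suc k))" using P_int by auto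
    show "AE x in \<nu>. norm (F k \<alpha> (idx k x)) \<le> norm (\<bar>P \<alpha> x\<bar> + 1 / real (Suc k))"
      using AE_K
    proof eventually_elim
      case (elim x)
      show ?case using F_close[OF elim that] by simp
    qed
  qed
  define \<kappa> where "\<kappa> k = distr \<nu> (count_space UNIV) (idx k)" for k
  have sets_\<kappa>: "sets (\<kappa> k) = UNIV" for k by (simp add: \<kappa>_def)
  have \<kappa>_int: "integrable (\<kappa> k) (F k \<alpha>)" if "to_nat \<alpha> < k" for k \<alpha>
    unfolding \<kappa>_def using F_int[OF that] by (subst integrable_distr_eq) auto
  have abs_le: "\<bar>t\<bar> \<le> 1 + t * t" for t :: real
    using abs_le_eps_square[of 1 t] by simp
  \<comment> \<open>The absolute value of a monomial is at most 1 plus its square, so the indices 0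
    and \<open>\<alpha> + \<alpha>\<close> must also have codes below \<open>k\<close>; the
    conclusion is thus available for all large \<open>k\<close>.\<close>
  have mix: "integrable (mixture (\<kappa> k) (N' k)) (mon_val \<alpha>)"
    "integral\<^sup>L (mixture (\<kappa> k) (N' k)) (mon_val \<alpha>) = (\<integral>x. F k \<alpha> (idx k x) \<partial>\<nu>)"
    if k: "to_nat \<alpha> < k" "to_nat (\<alpha> + \<alpha>) < k" "to_nat (\<lambda>_::'n. 0::nat) < k" for k \<alpha>
  proof -
    have "integrable (\<kappa> k) (\<lambda>i. \<integral>x. \<bar>mon_val \<alpha> x\<bar> \<partial>N' k i)"
    proof (rule Bochner_Integration.integrable_bound)
      show "integrable (\<kappa> k) (\<lambda>i. F k (\<lambda>_. 0) i + F k (\<alpha> + \<alpha>) i)"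
        using \<kappa>_int k by auto
      have "(\<integral>x. \<bar>mon_val \<alpha> x\<bar> \<partial>N' k i) \<le> F k (\<lambda>_. 0) i + F k (\<alpha> + \<alpha>) i" for i
      proof -
        have "(\<integral>x. \<bar>mon_val \<alpha> x\<bar> \<partial>N' k i) \<le> (\<integral>x. mon_val (\<lambda>_. 0) x + mon_val (\<alpha> + \<alpha>) x \<partial>N' k i)"
          by (intro integral_mono Bochner_Integration.integrable_add integrable_abs int_N')
            (simp add: mon_val_0 mon_val_add abs_le)
        also have "\<dots> = F k (\<lambda>_. 0) i + F k (\<alpha> + \<alpha>) i"
          by (subst Bochner_Integration.integral_add) (simp_all add: int_N' val_N')
        finally show ?thesis .
      qed
      moreover have "0 \<le> (\<integral>x. \<bar>mon_val \<alpha> x\<bar> \<partial>N' k i)" for i by simp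
      ultimately show "AE i in \<kappa> k. norm (\<integral>x. \<bar>mon_val \<alpha> x\<bar> \<partial>N' k i) \<le> norm (F k (\<lambda>_. 0) i + F k (\<alpha> + \<alpha>) i)"
        by (intro AE_I2) (smt (verit) real_norm_def)
    qed (auto simp: \<kappa>_def)
    note m = integral_mixture[OF sets_\<kappa> sets_N' measurable_mon_val int_N' this]
    show "integrable (mixture (\<kappa> k) (N' k)) (mon_val \<alpha>)" by (rule m)
    show "integral\<^sup>L (mixture (\<kappa> k) (N' k)) (mon_val \<alpha>) = (\<integral>x. F k \<alpha> (idx k x) \<partial>\<nu>)"
      unfolding m(2) val_N' unfolding \<kappa>_def by (subst integral_distr) auto
  qed
  have large: "eventually (\<lambda>k. to_nat \<alpha> < k \<and> to_nat (\<alpha> + \<alpha>) < k \<and> to_nat (\<lambda>_::'n. 0::nat) < k) sequentially"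
    for \<alpha> :: "'n \<Rightarrow> nat"
    by (intro eventually_conj eventually_gt_at_top)
  show ?thesis
  proof (rule is_moment_seqI_limit[where \<mu> = "\<lambda>k. mixture (\<kappa> k) (N' k)"])
    show "sets (mixture (\<kappa> k) (N' k)) = sets borel" for k
      by (rule sets_mixture[OF sets_\<kappa> sets_N'])
    show "closed K" by (rule K)
    show "emeasure (mixture (\<kappa> k) (N' k)) (UNIV - K) = 0" for k
      using K by (subst emeasure_mixture[OF sets_\<kappa> sets_N']) (auto simp: supp_N' borel_closed)
    show "eventually (\<lambda>k. integrable (mixture (\<kappa> k) (N' k)) (mon_val \<alpha>)) sequentially" for \<alpha>
      using large[of \<alpha>] by eventually_elim (auto intro: mix)
    fix \<alpha>
    have "(\<lambda>k. measure \<nu> UNIV * (1 / real (Suc k))) \<longlonglongrightarrow> measure \<nu> UNIV * 0"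
      by (intro tendsto_intros LIMSEQ_inverse_real_of_nat[unfolded inverse_eq_divide])
    hence bound: "(\<lambda>k. measure \<nu> UNIV * (1 / real (Suc k))) \<longlonglongrightarrow> 0" by simp
    \<comment> \<open>The mixture moment is the integral of the step function, so its error is at
      most the mass of \<open>\<nu>\<close> times the cell tolerance.\<close>
    have "eventually (\<lambda>k. norm (integral\<^sup>L (mixture (\<kappa> k) (N' k)) (mon_val \<alpha>) - (\<integral>y. P \<alpha> y \<partial>\<nu>))
        \<le> measure \<nu> UNIV * (1 / real (Suc k))) sequentially"
      using large[of \<alpha>]
    proof eventually_elim
      case (elim k)
      have "norm (integral\<^sup>L (mixture (\<kappa> k) (N' k)) (mon_val \<alpha>) - (\<integral>y. P \<alpha> y \<partial>\<nu>))
          = \<bar>\<integral>x. F k \<alpha> (idx k x) - P \<alpha> x \<partial>\<nu>\<bar>"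
        using elim F_int P_int by (simp add: mix)
      also have "\<dots> \<le> (\<integral>x. \<bar>F k \<alpha> (idx k x) - P \<alpha> x\<bar> \<partial>\<nu>)"
        by (rule integral_abs_bound)
      also have "\<dots> \<le> (\<integral>x. 1 / real (Suc k) \<partial>\<nu>)"
      proof (rule integral_mono_AE)
        show "AE x in \<nu>. \<bar>F k \<alpha> (idx k x) - P \<alpha> x\<bar> \<le> 1 / real (Suc k)"
          using AE_K by eventually_elim (rule F_close; use elim in auto)
      qed (use elim F_int P_int in auto)
      finally show ?case by (simp add: sp)
    qed
    thus "(\<lambda>k. integral\<^sup>L (mixture (\<kappa> k) (N' k)) (mon_val \<alpha>)) \<longlonglongrightarrow> (\<integral>y. P \<alpha> y \<partial>\<nu>)"
      by (rule LIM_zero_cancel[OF Lim_null_comparison[OF _ bound]])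
  qed
qed

section \<open>Translation of moment sequences\<close>

definition mchoose :: "('n::finite \<Rightarrow> nat) \<Rightarrow> ('n \<Rightarrow> nat) \<Rightarrow> real" where
  "mchoose \<alpha> \<beta> = (\<Prod>i\<in>UNIV. real (\<alpha> i choose \<beta> i))"

text \<open>If \<open>c\<close> lists the moments of a measure about \<open>y\<close>, then \<open>recenter y c\<close> lists its
  moments about the origin.\<close>

definition recenter :: "real^'n::finite \<Rightarrow> (('n \<Rightarrow> nat) \<Rightarrow> real) \<Rightarrow> ('n \<Rightarrow> nat) \<Rightarrow> real" where
  "recenter y c \<alpha> = (\<Sum>\<beta>\<in>{\<beta>. \<beta> \<le> \<alpha>}. mchoose \<alpha> \<beta> * mon_val (\<alpha> - \<beta>) y * c \<beta>)"

lemma le_multiindex_eq_PiE: "{\<beta>. \<beta> \<le> \<alpha>} = PiE UNIV (\<lambda>i. {..\<alpha> i :: nat})"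
  by (auto simp: le_fun_def PiE_def Pi_def)

lemma finite_le_multiindex: "finite {\<beta> :: 'n::finite \<Rightarrow> nat. \<beta> \<le> \<alpha>}"
  unfolding le_multiindex_eq_PiE by (intro finite_PiE) auto

lemma mon_val_translate: "mon_val \<alpha> (x + y) = recenter y (\<lambda>\<beta>. mon_val \<beta> x) \<alpha>"
proof -
  have "mon_val \<alpha> (x + y) = (\<Prod>i\<in>UNIV. \<Sum>k\<in>{..\<alpha> i}. real (\<alpha> i choose k) * (x $ i) ^ k * (y $ i) ^ (\<alpha> i - k))"
    unfolding mon_val_def by (simp add: binomial_ring)
  also have "\<dots> = (\<Sum>\<beta>\<in>{\<beta>. \<beta> \<le> \<alpha>}. \<Prod>i\<in>UNIV. real (\<alpha> i choose \<beta> i) * (x $ i) ^ \<beta> i * (y $ i) ^ (\<alpha> i - \<beta> i))"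
    unfolding le_multiindex_eq_PiE by (rule prod_sum_PiE) auto
  also have "\<dots> = recenter y (\<lambda>\<beta>. mon_val \<beta> x) \<alpha>"
    unfolding recenter_def mchoose_def mon_val_def
    by (simp add: prod.distrib mult_ac)
  finally show ?thesis .
qed

text \<open>\<open>recenter y\<close> is triangular with unit diagonal: the coefficient at
  \<open>\<beta> = \<alpha>\<close> is 1 and every other index has smaller total degree, so
  induction on the degree recovers \<open>c\<close>.\<close>

lemma recenter_inject:
  assumes "recenter y c = recenter y c'"
  shows "c = c'"
proof
  fix \<alpha>
  show "c \<alpha> = c' \<alpha>"
  proof (induction "\<Sum>i\<in>UNIV. \<alpha> i" arbitrary: \<alpha> rule: less_induct)
    case less
    have split: "recenter y d \<alpha> = d \<alpha> + (\<Sum>\<beta>\<in>{\<beta>. \<beta> \<le> \<alpha>} - {\<alpha>}. mchoose \<alpha> \<beta> * mon_val (\<alpha> - \<beta>) y * d \<beta>)" for d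
      unfolding recenter_def
      by (subst sum.remove[OF finite_le_multiindex, of \<alpha>]) (auto simp: mchoose_def mon_val_def)
    have "c \<beta> = c' \<beta>" if "\<beta> \<in> {\<beta>. \<beta> \<le> \<alpha>} - {\<alpha>}" for \<beta>
    proof (rule less)
      have le: "\<beta> i \<le> \<alpha> i" for i using that by (auto simp: le_fun_def)
      from that have "\<beta> \<noteq> \<alpha>" by simp
      then obtain i where "\<beta> i \<noteq> \<alpha> i" by (meson ext)
      with le[of i] have "\<beta> i < \<alpha> i" by simp
      thus "(\<Sum>i\<in>UNIV. \<beta> i) < (\<Sum>i\<in>UNIV. \<alpha> i)"
        using le by (intro sum_strict_mono_ex1) auto
    qed
    hence "(\<Sum>\<beta>\<in>{\<beta>. \<beta> \<le> \<alpha>} - {\<alpha>}. mchoose \<alpha> \<beta> * mon_val (\<alpha> - \<beta>) y * c \<beta>)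
        = (\<Sum>\<beta>\<in>{\<beta>. \<beta> \<le> \<alpha>} - {\<alpha>}. mchoose \<alpha> \<beta> * mon_val (\<alpha> - \<beta>) y * c' \<beta>)"
      by (intro sum.cong refl) simp
    thus ?case using fun_cong[OF assms, of \<alpha>] by (simp add: split)
  qed
qed

lemma translated_moments:
  fixes \<mu> :: "(real^'n::finite) measure"
  assumes sets_\<mu>[measurable_cong]: "sets \<mu> = sets borel" and int: "\<And>\<alpha>. integrable \<mu> (mon_val \<alpha>)"
  shows "integrable (distr \<mu> borel (\<lambda>x. x + y)) (mon_val \<alpha>)"
    and "integral\<^sup>L (distr \<mu> borel (\<lambda>x. x + y)) (mon_val \<alpha>)
      = recenter y (\<lambda>\<beta>. integral\<^sup>L \<mu> (mon_val \<beta>)) \<alpha>"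
proof -
  have eq: "(\<lambda>x. mon_val \<alpha> (x + y)) = (\<lambda>x. recenter y (\<lambda>\<beta>. mon_val \<beta> x) \<alpha>)"
    by (simp add: mon_val_translate)
  show "integrable (distr \<mu> borel (\<lambda>x. x + y)) (mon_val \<alpha>)"
    using int by (subst integrable_distr_eq) (auto simp: eq recenter_def)
  show "integral\<^sup>L (distr \<mu> borel (\<lambda>x. x + y)) (mon_val \<alpha>)
      = recenter y (\<lambda>\<beta>. integral\<^sup>L \<mu> (mon_val \<beta>)) \<alpha>"
    using int by (subst integral_distr) (auto simp: eq recenter_def)
qed

lemma emeasure_translate_compl:
  fixes K :: "(real^'n::finite) set"
  assumes K: "closed K" and sets_\<mu>[measurable_cong]: "sets \<mu> = sets borel"
  shows "emeasure (distr \<mu> borel (\<lambda>x. x + y)) (UNIV - K) = emeasure \<mu> (UNIV - (\<lambda>k. k - y) ` K)"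
proof -
  have "(\<lambda>x. x + y) -` (UNIV - K) \<inter> space \<mu> = UNIV - (\<lambda>k. k - y) ` K"
    using sets_eq_imp_space_eq[OF sets_\<mu>] by (force simp: image_iff algebra_simps)
  thus ?thesis using K by (subst emeasure_distr) (auto simp: borel_closed)
qed

text \<open>Translation by \<open>y\<close> carries representing measures on K - y to measures on
  \<open>K\<close> and changes moments by \<open>recenter y\<close>; translating back and cancelling
  \<open>recenter y\<close> gives the converse.\<close>

lemma is_moment_seq_translate:
  fixes K :: "(real^'n::finite) set"
  assumes K: "closed K"
  shows "is_moment_seq ((\<lambda>k. k - y) ` K) c \<longleftrightarrow> is_moment_seq K (recenter y c)"
proof
  assume "is_moment_seq ((\<lambda>k. k - y) ` K) c"
  then obtain \<mu> :: "(real^'n) measure" where \<mu>: "sets \<mu> = sets borel"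
    "emeasure \<mu> (UNIV - (\<lambda>k. k - y) ` K) = 0" "\<And>\<alpha>. integrable \<mu> (mon_val \<alpha>)"
    "\<And>\<alpha>. c \<alpha> = integral\<^sup>L \<mu> (mon_val \<alpha>)"
    unfolding is_moment_seq_def by blast
  have c: "c = (\<lambda>\<beta>. integral\<^sup>L \<mu> (mon_val \<beta>))" using \<mu>(4) by (rule ext)
  show "is_moment_seq K (recenter y c)"
    unfolding is_moment_seq_def c
  proof (intro exI[of _ "distr \<mu> borel (\<lambda>x. x + y)"] conjI allI)
    show "emeasure (distr \<mu> borel (\<lambda>x. x + y)) (UNIV - K) = 0"
      using emeasure_translate_compl[OF K \<mu>(1)] \<mu>(2) by simp
  qed (simp_all add: translated_moments[OF \<mu>(1,3)])
next
  assume "is_moment_seq K (recenter y c)"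
  then obtain \<mu> :: "(real^'n) measure" where \<mu>: "sets \<mu> = sets borel"
    "emeasure \<mu> (UNIV - K) = 0" "\<And>\<alpha>. integrable \<mu> (mon_val \<alpha>)"
    "\<And>\<alpha>. recenter y c \<alpha> = integral\<^sup>L \<mu> (mon_val \<alpha>)"
    unfolding is_moment_seq_def by blast
  note [measurable_cong] = \<mu>(1)
  define \<mu>' where "\<mu>' = distr \<mu> borel (\<lambda>x. x + - y)"
  have sets': "sets \<mu>' = sets borel" by (simp add: \<mu>'_def)
  have int': "integrable \<mu>' (mon_val \<alpha>)" for \<alpha>
    unfolding \<mu>'_def by (rule translated_moments(1)[OF \<mu>(1,3)])
  have inverse_translation: "distr \<mu>' borel (\<lambda>x. x + y) = \<mu>"
  proof -
    have "distr \<mu>' borel (\<lambda>x. x + y) = distr \<mu> borel ((\<lambda>x. x + y) \<circ> (\<lambda>x. x + - y))"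
      unfolding \<mu>'_def by (rule distr_distr) measurable
    also have "\<dots> = \<mu>" using \<mu>(1) by (simp add: comp_def distr_id2)
    finally show ?thesis .
  qed
  \<comment> \<open>The moments of \<open>\<mu>'\<close> are found indirectly: translating it
    forward again yields \<open>\<mu>\<close>, and injectivity of \<open>recenter y\<close>
    identifies them with \<open>c\<close>.\<close>
  have "recenter y c \<alpha> = recenter y (\<lambda>\<beta>. integral\<^sup>L \<mu>' (mon_val \<beta>)) \<alpha>" for \<alpha>
    using translated_moments(2)[OF sets' int', of y \<alpha>] unfolding inverse_translation \<mu>(4) .
  hence c: "c = (\<lambda>\<beta>. integral\<^sup>L \<mu>' (mon_val \<beta>))"
    by (intro recenter_inject[of y c] ext)
  have "emeasure \<mu>' (UNIV - (\<lambda>k. k - y) ` K) = 0"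
    using emeasure_translate_compl[OF K sets', of y] \<mu>(2) by (simp add: inverse_translation)
  thus "is_moment_seq ((\<lambda>k. k - y) ` K) c"
    unfolding is_moment_seq_def c using sets' int' by (intro exI[of _ \<mu>']) simp
qed

section \<open>The dual operator\<close>

lemma riesz_superset:
  assumes "finite A" "Poly_Mapping.keys p \<subseteq> A"
  shows "riesz s p = (\<Sum>\<alpha>\<in>A. Poly_Mapping.lookup p \<alpha> * s \<alpha>)"
  unfolding riesz_def using assms
  by (intro sum.mono_neutral_left) (auto simp: in_keys_iff)

lemma riesz_add: "riesz s (p + r) = riesz s p + riesz s r"
proof -
  let ?A = "Poly_Mapping.keys p \<union> Poly_Mapping.keys r"
  have "riesz s t = (\<Sum>\<alpha>\<in>?A. Poly_Mapping.lookup t \<alpha> * s \<alpha>)" if "t \<in> {p, r, p + r}" for t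
    using that Poly_Mapping.keys_add[of p r] by (intro riesz_superset) auto
  thus ?thesis by (simp add: lookup_add algebra_simps sum.distrib)
qed

lemma riesz_0: "riesz s 0 = 0"
  by (simp add: riesz_def)

lemma riesz_sum: "riesz s (\<Sum>i\<in>I. p i) = (\<Sum>i\<in>I. riesz s (p i))"
  by (induction I rule: infinite_finite_induct) (simp_all add: riesz_0 riesz_add)

lemma riesz_single: "riesz s (Poly_Mapping.single \<alpha> c) = c * s \<alpha>"
  by (simp add: riesz_def)

lemma peval_eq_riesz: "peval p x = riesz (\<lambda>\<alpha>. mon_val \<alpha> x) p"
  by (simp add: peval_def riesz_def)

lemma sum_monomials: "(\<Sum>\<alpha>\<in>Poly_Mapping.keys p. Poly_Mapping.single \<alpha> (Poly_Mapping.lookup p \<alpha>)) = p"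
  by (rule poly_mapping_eqI)
    (simp add: Poly_Mapping.lookup_sum lookup_single when_def in_keys_iff)

lemma peval_mult_single:
  "peval (p * Poly_Mapping.single \<beta> c) x = peval p x * (c * mon_val \<beta> x)"
proof -
  have "peval (p * Poly_Mapping.single \<beta> c) x = (\<Sum>\<alpha>\<in>Poly_Mapping.keys p.
      peval (Poly_Mapping.single \<alpha> (Poly_Mapping.lookup p \<alpha>) * Poly_Mapping.single \<beta> c) x)"
    by (subst (1) sum_monomials[of p, symmetric])
      (simp only: sum_distrib_right peval_eq_riesz riesz_sum)
  also have "\<dots> = (\<Sum>\<alpha>\<in>Poly_Mapping.keys p. Poly_Mapping.lookup p \<alpha> * mon_val \<alpha> x * (c * mon_val \<beta> x))"
    by (simp add: mult_single peval_eq_riesz riesz_single mon_val_add mult_ac)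
  also have "\<dots> = peval p x * (c * mon_val \<beta> x)"
    unfolding peval_def by (rule sum_distrib_right[symmetric])
  finally show ?thesis .
qed

lemma continuous_on_peval: "continuous_on S (peval p)"
  unfolding peval_def by (intro continuous_intros continuous_on_mon_val)

lemma riesz_moments:
  assumes "\<And>\<alpha>. integrable \<nu> (mon_val \<alpha>)"
  shows "integrable \<nu> (peval p)"
    and "riesz (\<lambda>\<alpha>. integral\<^sup>L \<nu> (mon_val \<alpha>)) p = integral\<^sup>L \<nu> (peval p)"
  unfolding peval_def[abs_def] riesz_def using assms by simp_all

text \<open>Differentiating a monomial of index \<open>\<alpha>\<close> produces the factor
  \<open>mfact \<alpha> / mfact (\<alpha> - \<beta>)\<close>, which is the binomial coefficient of
  the translation formula times \<open>mfact \<beta>\<close>. This is the origin of the factorials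
  in condition (ii).\<close>

lemma peval_diff_op_monomial:
  "peval (diff_op q (Poly_Mapping.single \<alpha> 1)) y = recenter y (\<lambda>\<beta>. mfact \<beta> * peval (q \<beta>) y) \<alpha>"
proof -
  have pd: "pderiv_multi \<beta> (Poly_Mapping.single \<alpha> 1)
      = Poly_Mapping.single (\<alpha> - \<beta>) (mfact \<alpha> / mfact (\<alpha> - \<beta>))" if "\<beta> \<le> \<alpha>" for \<beta>
  proof -
    have "{\<gamma> \<in> Poly_Mapping.keys (Poly_Mapping.single \<alpha> (1::real)). \<beta> \<le> \<gamma>} = {\<alpha>}" using that by auto
    thus ?thesis by (simp add: pderiv_multi_def)
  qed
  have fact: "mfact \<alpha> / mfact (\<alpha> - \<beta>) = mchoose \<alpha> \<beta> * mfact \<beta>" if "\<beta> \<le> \<alpha>" for \<beta>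
  proof -
    have "fact (\<alpha> i) / fact (\<alpha> i - \<beta> i) = real (\<alpha> i choose \<beta> i) * fact (\<beta> i)" for i
      using that by (simp add: binomial_fact le_fun_def)
    thus ?thesis
      unfolding mfact_def mchoose_def prod_dividef[symmetric] prod.distrib[symmetric] by simp
  qed
  have "peval (diff_op q (Poly_Mapping.single \<alpha> 1)) y
      = (\<Sum>\<beta>\<in>{\<beta>. \<beta> \<le> \<alpha>}. peval (q \<beta> * pderiv_multi \<beta> (Poly_Mapping.single \<alpha> 1)) y)"
    by (simp add: diff_op_def peval_eq_riesz riesz_sum)
  also have "\<dots> = recenter y (\<lambda>\<beta>. mfact \<beta> * peval (q \<beta>) y) \<alpha>"
    unfolding recenter_def
    by (intro sum.cong refl) (simp add: pd peval_mult_single fact mult_ac)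
  finally show ?thesis .
qed

theorem mainTheorem2:
  fixes K :: "(real^'n::finite) set"
    and q :: "('n \<Rightarrow> nat) \<Rightarrow> 'n mpoly"
    and S :: "(('n \<Rightarrow> nat) \<Rightarrow> real) \<Rightarrow> (('n \<Rightarrow> nat) \<Rightarrow> real)"
  assumes "closed K"
    and "\<And>s p. riesz (S s) p = riesz s (diff_op q p)"
  shows "(\<forall>s. is_moment_seq K s \<longrightarrow> is_moment_seq K (S s)) \<longleftrightarrow>
         (\<forall>y\<in>K. is_moment_seq ((\<lambda>k. k - y) ` K) (\<lambda>\<alpha>. mfact \<alpha> * peval (q \<alpha>) y))"
proof -
  \<comment> \<open>These polynomials, the images of the monomials under T, determine the dual
    operator: \<open>S s \<alpha>\<close> is the Riesz functional of \<open>s\<close> at the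
    polynomial defining \<open>P \<alpha>\<close>.\<close>
  define P where "P \<alpha> = peval (diff_op q (Poly_Mapping.single \<alpha> 1))" for \<alpha>
  have S: "S s \<alpha> = riesz s (diff_op q (Poly_Mapping.single \<alpha> 1))" for s \<alpha>
    using assms(2)[of s "Poly_Mapping.single \<alpha> 1"] by (simp add: riesz_single)
  have P: "(\<lambda>\<alpha>. P \<alpha> y) = recenter y (\<lambda>\<beta>. mfact \<beta> * peval (q \<beta>) y)" for y
    by (simp add: P_def peval_diff_op_monomial)
  have "(\<forall>s. is_moment_seq K s \<longrightarrow> is_moment_seq K (S s)) \<longleftrightarrow> (\<forall>y\<in>K. is_moment_seq K (\<lambda>\<alpha>. P \<alpha> y))"
  proof (intro iffI allI impI ballI)
    fix y assume *: "\<forall>s. is_moment_seq K s \<longrightarrow> is_moment_seq K (S s)" and "y \<in> K"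
    \<comment> \<open>These are the moments of the Dirac measure at \<open>y\<close>. Their Riesz
      functional is evaluation at \<open>y\<close>, so \<open>S\<close> sends them to the values
      \<open>P \<alpha> y\<close>.\<close>
    have "is_moment_seq K (\<lambda>\<alpha>. mon_val \<alpha> y)"
      unfolding is_moment_seq_def
    proof (intro exI[of _ "return borel y"] conjI allI)
      show "emeasure (return borel y) (UNIV - K) = 0"
        using \<open>y \<in> K\<close> \<open>closed K\<close> by (simp add: borel_closed)
      fix \<alpha> :: "'n \<Rightarrow> nat"
      interpret prob_space "return borel y" by (rule prob_space_return) simp
      show "mon_val \<alpha> y = integral\<^sup>L (return borel y) (mon_val \<alpha>)"
        by (subst integral_return) auto
      show "integrable (return borel y) (mon_val \<alpha>)"
        by (rule integrable_const_bound[of _ "\<bar>mon_val \<alpha> y\<bar>"]) (auto simp: AE_return)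
    qed simp
    with * have "is_moment_seq K (S (\<lambda>\<alpha>. mon_val \<alpha> y))" by blast
    moreover have "S (\<lambda>\<alpha>. mon_val \<alpha> y) = (\<lambda>\<alpha>. P \<alpha> y)"
      by (auto simp: S P_def peval_eq_riesz)
    ultimately show "is_moment_seq K (\<lambda>\<alpha>. P \<alpha> y)" by simp
  next
    fix s assume *: "\<forall>y\<in>K. is_moment_seq K (\<lambda>\<alpha>. P \<alpha> y)" and "is_moment_seq K s"
    then obtain \<nu> :: "(real^'n) measure" where \<nu>: "sets \<nu> = sets borel"
      "emeasure \<nu> (UNIV - K) = 0" "\<And>\<alpha>. integrable \<nu> (mon_val \<alpha>)"
      "\<And>\<alpha>. s \<alpha> = integral\<^sup>L \<nu> (mon_val \<alpha>)"
      unfolding is_moment_seq_def by blast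
    \<comment> \<open>The monomial of index 0 is constantly 1, so its integrability makes the mass
      finite.\<close>
    have "finite_measure \<nu>"
    proof
      show "emeasure \<nu> (space \<nu>) \<noteq> \<infinity>"
        using nn_integral_eq_integral[OF \<nu>(3)[of "\<lambda>_. 0"]] by (simp add: mon_val_0)
    qed
    moreover have "P \<alpha> \<in> borel_measurable borel" for \<alpha>
      unfolding P_def by (rule borel_measurable_continuous_onI[OF continuous_on_peval])
    moreover have "integrable \<nu> (P \<alpha>)" for \<alpha>
      unfolding P_def by (rule riesz_moments(1)[OF \<nu>(3)])
    ultimately have "is_moment_seq K (\<lambda>\<alpha>. \<integral>y. P \<alpha> y \<partial>\<nu>)"
      using * by (intro is_moment_seq_average \<open>closed K\<close> \<nu>(1,2)) auto
    moreover have "s = (\<lambda>\<alpha>. integral\<^sup>L \<nu> (mon_val \<alpha>))"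
      using \<nu>(4) by auto
    \<comment> \<open>The Riesz functional of \<open>s\<close> integrates polynomials against
      \<open>\<nu>\<close>, so \<open>S s\<close> is the \<open>\<nu>\<close>-average of the
      sequences \<open>P \<alpha> y\<close>.\<close>
    hence "S s = (\<lambda>\<alpha>. \<integral>y. P \<alpha> y \<partial>\<nu>)"
      by (auto simp: S P_def riesz_moments(2)[OF \<nu>(3)])
    ultimately show "is_moment_seq K (S s)" by simp
  qed
  thus ?thesis
    by (simp add: P is_moment_seq_translate[OF \<open>closed K\<close>])
qed

end
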